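(* Assume that $\mathbf{W}_1,\dots,\mathbf{W}_T$ are independent. Let $p$ be a deterministic admissible price process and $r$ a deterministic admissible resource process, let $\underline{V}_t^i$ and $\overline{V}_t^i$ be the associated local price and resource value functions, and let $\underline{\gamma}$ and $\overline{\gamma}$ be a global price policy and a global resource policy built from them. Let $t\in\{0,\dots,T\}$ and let $x_t=(x_t^i)_{i\in\mathfrak{N}}\in\mathbb{X}_t$. Then $$\sum_{i\in\mathfrak{N}}\underline{V}_t^i(x_t^i)\le V_t(x_t)\le V_t^{\overline{\gamma}}(x_t)\le\sum_{i\in\mathfrak{N}}\overline{V}_t^i(x_t^i)$$ and $$V_t(x_t)\le\inf\big\{V_t^{\underline{\gamma}}(x_t),\,V_t^{\overline{\gamma}}(x_t)\big\}.$$
   Context: Data. $\mathfrak{N}$ is a finite set of units, $T\ge1$ an integer. For each $i\in\mathfrak{N}$ there are measurable spaces $\mathbb{X}_t^i$ ($0\le t\le T$), $\mathbb{U}_t^i$ ($0\le t\le T-1$), $\mathbb{W}_t^i$ ($1\le t\le T$), and measurable vector spaces $\mathcal{R}_t^i$ (resources), $\mathcal{P}_t^i$ (prices), $0\le t\le T-1$, paired by a bilinear form $\langle\cdot,\cdot\rangle:\mathcal{P}_t^i\times\mathcal{R}_t^i\to\mathbb{R}$. For $0\le t\le T-1$ there are measurable maps $g_t^i:\mathbb{X}_t^i\times\mathbb{U}_t^i\times\mathbb{W}_{t+1}^i\to\mathbb{X}_{t+1}^i$, $\Theta_t^i:\mathbb{X}_t^i\times\mathbb{U}_t^i\to\mathcal{R}_t^i$,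 $L_t^i:\mathbb{X}_t^i\times\mathbb{U}_t^i\times\mathbb{W}_{t+1}^i\to(-\infty,+\infty]$, and $K^i:\mathbb{X}_T^i\to(-\infty,+\infty]$ is measurable. Set $\mathbb{X}_t=\prod_i\mathbb{X}_t^i$, $\mathbb{U}_t=\prod_i\mathbb{U}_t^i$, $\mathcal{R}_t=\prod_i\mathcal{R}_t^i$, $\mathcal{P}_t=\prod_i\mathcal{P}_t^i$. A subset $S_t\subset\mathcal{R}_t$ is given for each $0\le t\le T-1$. On a probability space $(\Omega,\mathcal{A},\mathbb{P})$ there are random variables $\mathbf{W}_t^i:\Omega\to\mathbb{W}_t^i$, $1\le t\le T$; $\mathbf{W}_t=(\mathbf{W}_t^i)_{i}$, $\mathcal{F}_t=\sigma(\mathbf{W}_1,\dots,\mathbf{W}_t)$, $\mathcal{F}_0=\{\emptyset,\Omega\}$. Global value function (centralized information): $V_T((x_T^i)_i)=\sum_iK^i(x_T^i)$ and, for $t\le T-1$, $V_t((x_t^i)_i)=\inf\mathbb{E}\big[\sum_i\sum_{s=t}^{T-1}L_s^i(\mathbf{X}_s^i,\mathbf{U}_s^i,\mathbf{W}_{s+1}^i)+\sum_iK^i(\mathbf{X}_T^i)\big]$ over all processes with $\mathbf{X}_t^i=x_t^i$ and, for all $i$ and all $s\in\{t,\dots,T-1\}$, $\mathbf{X}_{s+1}^i=g_s^i(\mathbf{X}_s^i,\mathbf{U}_s^i,\mathbf{W}_{s+1}^i)$, $\sigma(\mathbf{U}_s^i)\subset\mathcal{F}_s$, and $(\Theta_s^i(\mathbf{X}_s^i,\mathbf{U}_s^i))_{i}\in-S_s$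 $\mathbb{P}$-a.s. Admissible deterministic processes. $p=(p_t^i)_{0\le t\le T-1,\,i\in\mathfrak{N}}$ with $p_t=(p_t^i)_i\in\mathcal{P}_t$ is admissible if for every $t$, $\sum_i\langle p_t^i,y^i\rangle\ge0$ for all $y\in S_t$. $r=(r_t^i)$ with $r_t=(r_t^i)_i\in\mathcal{R}_t$ is admissible if $r_t\in-S_t$ for every $t$. Local value functions. $\underline{V}_T^i=\overline{V}_T^i=K^i$ and, for $t=T-1,\dots,0$, $$\underline{V}_t^i(x_t^i)=\inf_{u_t^i\in\mathbb{U}_t^i}\mathbb{E}\big[L_t^i(x_t^i,u_t^i,\mathbf{W}_{t+1}^i)+\langle p_t^i,\Theta_t^i(x_t^i,u_t^i)\rangle+\underline{V}_{t+1}^i(g_t^i(x_t^i,u_t^i,\mathbf{W}_{t+1}^i))\big],$$ $$\overline{V}_t^i(x_t^i)=\inf_{u_t^i\in\mathbb{U}_t^i,\ \Theta_t^i(x_t^i,u_t^i)=r_t^i}\mathbb{E}\big[L_t^i(x_t^i,u_t^i,\mathbf{W}_{t+1}^i)+\overline{V}_{t+1}^i(g_t^i(x_t^i,u_t^i,\mathbf{W}_{t+1}^i))\big]$$ (infimum over the empty set is $+\infty$). It is supposed that $\underline{V}_t^i<+\infty$ and $\overline{V}_t^i>-\infty$. Policies. A policy is a sequence $\gamma=(\gamma_t)_{0\le t\le T-1}$ of measurable maps $\gamma_t=(\gamma_t^i)_i:\mathbb{X}_t\to\mathbb{U}_t$. A global price policy $\underline{\gamma}$ satisfies, for all $t$ and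 all $x_t\in\mathbb{X}_t$, $$\underline{\gamma}_t(x_t)\in\arg\min_{(u_t^i)_i}\ \mathbb{E}\Big[\sum_{i}L_t^i(x_t^i,u_t^i,\mathbf{W}_{t+1}^i)+\underline{V}_{t+1}^i\big(g_t^i(x_t^i,u_t^i,\mathbf{W}_{t+1}^i)\big)\Big]\quad\text{s.t. }(\Theta_t^i(x_t^i,u_t^i))_{i}\in-S_t$$ (the sum over $i$ covers both terms). A global resource policy $\overline{\gamma}$ is defined in the same way with $\overline{V}_{t+1}^i$ in place of $\underline{V}_{t+1}^i$. It is supposed that the argmins are nonempty and that the resulting maps are measurable. Cost of a policy $\gamma$: $V_t^\gamma(x_t)=\mathbb{E}\big[\sum_i\sum_{s=t}^{T-1}L_s^i(\mathbf{X}_s^i,\gamma_s^i(\mathbf{X}_s),\mathbf{W}_{s+1}^i)+\sum_iK^i(\mathbf{X}_T^i)\big]$, where $\mathbf{X}_t^i=x_t^i$ and $\mathbf{X}_{s+1}^i=g_s^i(\mathbf{X}_s^i,\gamma_s^i(\mathbf{X}_s),\mathbf{W}_{s+1}^i)$ for $s\in\{t,\dots,T-1\}$. Standing assumption: measurability and integrability assumptions hold so that all the expectations involved (including those of the duality products) are well defined. *)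

theory Defs
  imports "HOL-Probability.Probability"
begin

section \<open>Expectation of extended-real random variables\<close>

text \<open>
  The expectation is the integral of the positive part minus that of the negative part. It is only
  meaningful for measurable integrands for which these are not both infinite; this is the predicate
  \<open>has_expect\<close>. Outside that case the \<^typ>\<open>ereal\<close> convention \<open>\<infinity> - \<infinity> = \<infinity>\<close> gives the junk value \<open>\<infinity>\<close>.
\<close>

definition expect :: "'o measure \<Rightarrow> ('o \<Rightarrow> ereal) \<Rightarrow> ereal" where
  "expect M f =
     enn2ereal (\<integral>\<^sup>+\<omega>. e2ennreal (f \<omega>) \<partial>M) - enn2ereal (\<integral>\<^sup>+\<omega>. e2ennreal (- f \<omega>) \<partial>M)"

definition has_expect :: "'o measure \<Rightarrow> ('o \<Rightarrow> ereal) \<Rightarrow> bool" where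
  "has_expect M f \<longleftrightarrow> f \<in> borel_measurable M \<and>
     ((\<integral>\<^sup>+\<omega>. e2ennreal (f \<omega>) \<partial>M) < \<infinity> \<or> (\<integral>\<^sup>+\<omega>. e2ennreal (- f \<omega>) \<partial>M) < \<infinity>)"

section \<open>Measurable vector spaces in duality\<close>

text \<open>A vector space here is a subspace of an ambient vector space type.\<close>

definition measurable_vector_space :: "'v::real_vector measure \<Rightarrow> bool" where
  "measurable_vector_space V \<longleftrightarrow> subspace (space V) \<and>
     (\<lambda>(a, b). a + b) \<in> V \<Otimes>\<^sub>M V \<rightarrow>\<^sub>M V \<and>
     (\<lambda>(c, a). c *\<^sub>R a) \<in> borel \<Otimes>\<^sub>M V \<rightarrow>\<^sub>M V"

definition bilinear_form_on ::
  "'p::real_vector set \<Rightarrow> 'r::real_vector set \<Rightarrow> ('p \<Rightarrow> 'r \<Rightarrow> real) \<Rightarrow> bool" where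
  "bilinear_form_on P R b \<longleftrightarrow>
     (\<forall>p\<in>P. \<forall>p'\<in>P. \<forall>y\<in>R. b (p + p') y = b p y + b p' y) \<and>
     (\<forall>c. \<forall>p\<in>P. \<forall>y\<in>R. b (c *\<^sub>R p) y = c * b p y) \<and>
     (\<forall>p\<in>P. \<forall>y\<in>R. \<forall>y'\<in>R. b p (y + y') = b p y + b p y') \<and>
     (\<forall>c. \<forall>p\<in>P. \<forall>y\<in>R. b p (c *\<^sub>R y) = c * b p y)"

section \<open>Data of the multistage problem\<close>

text \<open>
  The spaces depend on time and unit. Each such family lives in one ambient type, the individual
  space being the \<^const>\<open>space\<close> of the measurable space with that index. Products over units are
  \<^const>\<open>PiM\<close> products, whose elements are extensional functions on the set of units.
\<close>

record ('i, 'x, 'u, 'w, 'r, 'p, 'o) multistage =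
  units :: "'i set"
  horizon :: nat
  state_sp :: "nat \<Rightarrow> 'i \<Rightarrow> 'x measure"
  control_sp :: "nat \<Rightarrow> 'i \<Rightarrow> 'u measure"
  noise_sp :: "nat \<Rightarrow> 'i \<Rightarrow> 'w measure"
  resource_sp :: "nat \<Rightarrow> 'i \<Rightarrow> 'r measure"
  price_sp :: "nat \<Rightarrow> 'i \<Rightarrow> 'p measure"
  pairing :: "nat \<Rightarrow> 'i \<Rightarrow> 'p \<Rightarrow> 'r \<Rightarrow> real"
  dyn :: "nat \<Rightarrow> 'i \<Rightarrow> 'x \<Rightarrow> 'u \<Rightarrow> 'w \<Rightarrow> 'x"
  resource :: "nat \<Rightarrow> 'i \<Rightarrow> 'x \<Rightarrow> 'u \<Rightarrow> 'r"
  stage_cost :: "nat \<Rightarrow> 'i \<Rightarrow> 'x \<Rightarrow> 'u \<Rightarrow> 'w \<Rightarrow> ereal"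
  final_cost :: "'i \<Rightarrow> 'x \<Rightarrow> ereal"
  coupling :: "nat \<Rightarrow> ('i \<Rightarrow> 'r) set"
  prob_sp :: "'o measure"
  noise :: "nat \<Rightarrow> 'i \<Rightarrow> 'o \<Rightarrow> 'w"

definition global_state_sp where
  "global_state_sp D t = PiM (units D) (state_sp D t)"

definition global_control_sp where
  "global_control_sp D t = PiM (units D) (control_sp D t)"

definition global_noise_sp where
  "global_noise_sp D t = PiM (units D) (noise_sp D t)"

definition global_resource_sp where
  "global_resource_sp D t = PiM (units D) (resource_sp D t)"

definition global_noise where
  "global_noise D t \<omega> = (\<lambda>i\<in>units D. noise D t i \<omega>)"

text \<open>The set \<open>- S\<^sub>t\<close> in the product vector space.\<close>

definition neg_coupling where
  "neg_coupling D t = (\<lambda>y. \<lambda>i\<in>units D. - y i) ` coupling D t"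

definition well_posed ::
  "('i, 'x, 'u, 'w, 'r::real_vector, 'p::real_vector, 'o) multistage \<Rightarrow> bool" where
  "well_posed D \<longleftrightarrow>
     finite (units D) \<and> 1 \<le> horizon D \<and> prob_space (prob_sp D) \<and>
     (\<forall>t<horizon D. \<forall>i\<in>units D.
        measurable_vector_space (resource_sp D t i) \<and>
        measurable_vector_space (price_sp D t i) \<and>
        bilinear_form_on (space (price_sp D t i)) (space (resource_sp D t i)) (pairing D t i) \<and>
        (\<lambda>(p, y). pairing D t i p y)
          \<in> borel_measurable (price_sp D t i \<Otimes>\<^sub>M resource_sp D t i) \<and>
        (\<lambda>(x, u, w). dyn D t i x u w)
          \<in> state_sp D t i \<Otimes>\<^sub>M control_sp D t i \<Otimes>\<^sub>M noise_sp D (Suc t) i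
            \<rightarrow>\<^sub>M state_sp D (Suc t) i \<and>
        (\<lambda>(x, u). resource D t i x u)
          \<in> state_sp D t i \<Otimes>\<^sub>M control_sp D t i \<rightarrow>\<^sub>M resource_sp D t i \<and>
        (\<lambda>(x, u, w). stage_cost D t i x u w)
          \<in> borel_measurable
              (state_sp D t i \<Otimes>\<^sub>M control_sp D t i \<Otimes>\<^sub>M noise_sp D (Suc t) i) \<and>
        (\<forall>x\<in>space (state_sp D t i). \<forall>u\<in>space (control_sp D t i).
           \<forall>w\<in>space (noise_sp D (Suc t) i). - \<infinity> < stage_cost D t i x u w)) \<and>
     (\<forall>i\<in>units D.
        final_cost D i \<in> borel_measurable (state_sp D (horizon D) i) \<and>
        (\<forall>x\<in>space (state_sp D (horizon D) i). - \<infinity> < final_cost D i x)) \<and>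
     (\<forall>t<horizon D. coupling D t \<subseteq> space (global_resource_sp D t)) \<and>
     (\<forall>t\<in>{1..horizon D}. \<forall>i\<in>units D. noise D t i \<in> prob_sp D \<rightarrow>\<^sub>M noise_sp D t i)"

section \<open>Global value functions under centralized information\<close>

definition noise_filtration where
  "noise_filtration D t =
     sigma (space (prob_sp D))
       (\<Union>s\<in>{1..t}. {global_noise D s -` A \<inter> space (prob_sp D) | A. A \<in> sets (global_noise_sp D s)})"

definition total_cost where
  "total_cost D t X U \<omega> =
     (\<Sum>i\<in>units D. \<Sum>s = t..<horizon D.
        stage_cost D s i (X s i \<omega>) (U s i \<omega>) (noise D (Suc s) i \<omega>)) +
     (\<Sum>i\<in>units D. final_cost D i (X (horizon D) i \<omega>))"

definition admissible_processes ::
  "('i, 'x, 'u, 'w, 'r::real_vector, 'p, 'o) multistage \<Rightarrow> nat \<Rightarrow> ('i \<Rightarrow> 'x) \<Rightarrow>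
   ((nat \<Rightarrow> 'i \<Rightarrow> 'o \<Rightarrow> 'x) \<times> (nat \<Rightarrow> 'i \<Rightarrow> 'o \<Rightarrow> 'u)) set" where
  "admissible_processes D t x = {(X, U).
     (\<forall>i\<in>units D. \<forall>\<omega>\<in>space (prob_sp D). X t i \<omega> = x i) \<and>
     (\<forall>s\<in>{t..<horizon D}. \<forall>i\<in>units D.
        (\<forall>\<omega>\<in>space (prob_sp D).
           X (Suc s) i \<omega> = dyn D s i (X s i \<omega>) (U s i \<omega>) (noise D (Suc s) i \<omega>)) \<and>
        U s i \<in> noise_filtration D s \<rightarrow>\<^sub>M control_sp D s i) \<and>
     (\<forall>s\<in>{t..<horizon D}. AE \<omega> in prob_sp D.
        (\<lambda>i\<in>units D. resource D s i (X s i \<omega>) (U s i \<omega>)) \<in> neg_coupling D s)}"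

definition global_value ::
  "('i, 'x, 'u, 'w, 'r::real_vector, 'p, 'o) multistage \<Rightarrow> nat \<Rightarrow> ('i \<Rightarrow> 'x) \<Rightarrow> ereal" where
  "global_value D t x =
     (if t < horizon D
      then INF (X, U) \<in> admissible_processes D t x. expect (prob_sp D) (total_cost D t X U)
      else \<Sum>i\<in>units D. final_cost D i (x i))"

section \<open>Local value functions\<close>

definition price_admissible ::
  "('i, 'x, 'u, 'w, 'r, 'p, 'o) multistage \<Rightarrow> (nat \<Rightarrow> 'i \<Rightarrow> 'p) \<Rightarrow> bool" where
  "price_admissible D p \<longleftrightarrow>
     (\<forall>t<horizon D. (\<forall>i\<in>units D. p t i \<in> space (price_sp D t i)) \<and>
        (\<forall>y\<in>coupling D t. 0 \<le> (\<Sum>i\<in>units D. pairing D t i (p t i) (y i))))"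

definition resource_admissible ::
  "('i, 'x, 'u, 'w, 'r::real_vector, 'p, 'o) multistage \<Rightarrow> (nat \<Rightarrow> 'i \<Rightarrow> 'r) \<Rightarrow> bool" where
  "resource_admissible D r \<longleftrightarrow>
     (\<forall>t<horizon D. (\<lambda>i\<in>units D. r t i) \<in> neg_coupling D t)"

text \<open>In the following two integrands, \<open>v\<close> is the local value function at time \<open>Suc t\<close>.\<close>

definition plain_integrand where
  "plain_integrand D t i v x u \<omega> =
     stage_cost D t i x u (noise D (Suc t) i \<omega>) + v (dyn D t i x u (noise D (Suc t) i \<omega>))"

definition price_integrand where
  "price_integrand D p t i v x u \<omega> =
     stage_cost D t i x u (noise D (Suc t) i \<omega>) +
     ereal (pairing D t i (p t i) (resource D t i x u)) +
     v (dyn D t i x u (noise D (Suc t) i \<omega>))"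

function price_value ::
  "('i, 'x, 'u, 'w, 'r, 'p, 'o) multistage \<Rightarrow> (nat \<Rightarrow> 'i \<Rightarrow> 'p) \<Rightarrow> nat \<Rightarrow> 'i \<Rightarrow> 'x \<Rightarrow> ereal"
where
  "price_value D p t i x =
     (if t < horizon D
      then INF u \<in> space (control_sp D t i).
             expect (prob_sp D) (price_integrand D p t i (price_value D p (Suc t) i) x u)
      else final_cost D i x)"
  by pat_completeness auto
termination
  by (relation "Wellfounded.measure (\<lambda>(D, p, t, i, x). horizon D - t)") auto

declare price_value.simps [simp del]

definition resource_controls where
  "resource_controls D r t i x =
     {u \<in> space (control_sp D t i). resource D t i x u = r t i}"

function resource_value ::
  "('i, 'x, 'u, 'w, 'r, 'p, 'o) multistage \<Rightarrow> (nat \<Rightarrow> 'i \<Rightarrow> 'r) \<Rightarrow> nat \<Rightarrow> 'i \<Rightarrow> 'x \<Rightarrow> ereal"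
where
  "resource_value D r t i x =
     (if t < horizon D
      then INF u \<in> resource_controls D r t i x.
             expect (prob_sp D) (plain_integrand D t i (resource_value D r (Suc t) i) x u)
      else final_cost D i x)"
  by pat_completeness auto
termination
  by (relation "Wellfounded.measure (\<lambda>(D, r, t, i, x). horizon D - t)") auto

declare resource_value.simps [simp del]

section \<open>Policies\<close>

definition feasible_control ::
  "('i, 'x, 'u, 'w, 'r::real_vector, 'p, 'o) multistage \<Rightarrow> nat \<Rightarrow> ('i \<Rightarrow> 'x) \<Rightarrow> ('i \<Rightarrow> 'u) \<Rightarrow> bool"
where
  "feasible_control D t x u \<longleftrightarrow> u \<in> space (global_control_sp D t) \<and>
     (\<lambda>i\<in>units D. resource D t i (x i) (u i)) \<in> neg_coupling D t"

definition policy_integrand where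
  "policy_integrand D V t x u \<omega> =
     (\<Sum>i\<in>units D. plain_integrand D t i (V (Suc t) i) (x i) (u i) \<omega>)"

definition policy ::
  "('i, 'x, 'u, 'w, 'r, 'p, 'o) multistage \<Rightarrow> (nat \<Rightarrow> ('i \<Rightarrow> 'x) \<Rightarrow> 'i \<Rightarrow> 'u) \<Rightarrow> bool" where
  "policy D \<gamma> \<longleftrightarrow> (\<forall>t<horizon D. \<gamma> t \<in> global_state_sp D t \<rightarrow>\<^sub>M global_control_sp D t)"

text \<open>Policies that are optimal one step ahead for a family \<open>V\<close> of local value functions.\<close>

definition global_policy ::
  "('i, 'x, 'u, 'w, 'r::real_vector, 'p, 'o) multistage \<Rightarrow> (nat \<Rightarrow> 'i \<Rightarrow> 'x \<Rightarrow> ereal) \<Rightarrow>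
   (nat \<Rightarrow> ('i \<Rightarrow> 'x) \<Rightarrow> 'i \<Rightarrow> 'u) \<Rightarrow> bool" where
  "global_policy D V \<gamma> \<longleftrightarrow> policy D \<gamma> \<and>
     (\<forall>t<horizon D. \<forall>x\<in>space (global_state_sp D t).
        is_arg_min (\<lambda>u. expect (prob_sp D) (policy_integrand D V t x u))
          (feasible_control D t x) (\<gamma> t x))"

definition global_price_policy where
  "global_price_policy D p \<gamma> \<longleftrightarrow> global_policy D (price_value D p) \<gamma>"

definition global_resource_policy where
  "global_resource_policy D r \<gamma> \<longleftrightarrow> global_policy D (resource_value D r) \<gamma>"

text \<open>
  State at time \<open>s\<close> of the trajectory that starts from \<open>x\<close> at time \<open>t\<close>; for \<open>s < t\<close> the value is
  irrelevant, and it is set to \<open>x\<close> to let the recursion on \<open>s\<close> start at \<open>0\<close>.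
\<close>

primrec policy_state ::
  "('i, 'x, 'u, 'w, 'r, 'p, 'o) multistage \<Rightarrow> (nat \<Rightarrow> ('i \<Rightarrow> 'x) \<Rightarrow> 'i \<Rightarrow> 'u) \<Rightarrow>
   nat \<Rightarrow> ('i \<Rightarrow> 'x) \<Rightarrow> nat \<Rightarrow> 'o \<Rightarrow> 'i \<Rightarrow> 'x" where
  "policy_state D \<gamma> t x 0 \<omega> = x"
| "policy_state D \<gamma> t x (Suc s) \<omega> =
     (if s < t then x
      else (\<lambda>i\<in>units D. dyn D s i (policy_state D \<gamma> t x s \<omega> i)
              (\<gamma> s (policy_state D \<gamma> t x s \<omega>) i) (noise D (Suc s) i \<omega>)))"

definition policy_cost where
  "policy_cost D \<gamma> t x =
     total_cost D t
       (\<lambda>s i \<omega>. policy_state D \<gamma> t x s \<omega> i)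
       (\<lambda>s i \<omega>. \<gamma> s (policy_state D \<gamma> t x s \<omega>) i)"

definition policy_value where
  "policy_value D \<gamma> t x = expect (prob_sp D) (policy_cost D \<gamma> t x)"

section \<open>Standing assumptions\<close>

text \<open>
  Every expectation occurring in the definitions above is well defined. The costs of the global
  price and resource policies are costs of admissible processes, so they are covered by the last
  conjunct. The local value functions are evaluated inside an expectation at times \<open>1, \<dots>, T\<close> only.
\<close>

definition expectations_well_defined ::
  "('i, 'x, 'u, 'w, 'r::real_vector, 'p, 'o) multistage \<Rightarrow>
   (nat \<Rightarrow> 'i \<Rightarrow> 'p) \<Rightarrow> (nat \<Rightarrow> 'i \<Rightarrow> 'r) \<Rightarrow> bool" where
  "expectations_well_defined D p r \<longleftrightarrow>
     (\<forall>t\<in>{1..horizon D}. \<forall>i\<in>units D.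
        price_value D p t i \<in> borel_measurable (state_sp D t i) \<and>
        resource_value D r t i \<in> borel_measurable (state_sp D t i)) \<and>
     (\<forall>t<horizon D. \<forall>i\<in>units D. \<forall>x\<in>space (state_sp D t i).
        (\<forall>u\<in>space (control_sp D t i). has_expect (prob_sp D)
           (price_integrand D p t i (price_value D p (Suc t) i) x u)) \<and>
        (\<forall>u\<in>resource_controls D r t i x. has_expect (prob_sp D)
           (plain_integrand D t i (resource_value D r (Suc t) i) x u))) \<and>
     (\<forall>t<horizon D. \<forall>x\<in>space (global_state_sp D t). \<forall>u. feasible_control D t x u \<longrightarrow>
        has_expect (prob_sp D) (policy_integrand D (price_value D p) t x u) \<and>
        has_expect (prob_sp D) (policy_integrand D (resource_value D r) t x u)) \<and>
     (\<forall>t<horizon D. \<forall>x\<in>space (global_state_sp D t). \<forall>(X, U)\<in>admissible_processes D t x.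
        has_expect (prob_sp D) (total_cost D t X U))"

text \<open>
  At the horizon the local value functions are the final costs, which never take the value \<open>-\<infinity>\<close>
  but may take the value \<open>\<infinity>\<close>; so the two bounds are required before the horizon only.
\<close>

definition local_values_bounded ::
  "('i, 'x, 'u, 'w, 'r, 'p, 'o) multistage \<Rightarrow>
   (nat \<Rightarrow> 'i \<Rightarrow> 'p) \<Rightarrow> (nat \<Rightarrow> 'i \<Rightarrow> 'r) \<Rightarrow> bool" where
  "local_values_bounded D p r \<longleftrightarrow>
     (\<forall>t<horizon D. \<forall>i\<in>units D. \<forall>x\<in>space (state_sp D t i).
        price_value D p t i x < \<infinity> \<and> - \<infinity> < resource_value D r t i x)"

end

theory Submission
  imports Defs
begin

text \<open>
  Everything rests on one comparison (\<open>expect_ge_of_conditional_ge\<close>, \<open>expect_le_of_conditional_le\<close>):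
  a random variable known at time \<open>s\<close> that lies below (above) the conditional mean of another one,
  given the past noise, has a smaller (larger) expectation. As \<open>W\<^bsub>s+1\<^esub>\<close> is independent of the
  past, this conditional mean is computed by freezing the past and averaging over \<open>W\<^bsub>s+1\<^esub>\<close> alone,
  which is the expectation occurring in the Bellman recursions of the local value functions.

  Consider an adapted trajectory and the process \<open>B\<^sub>s\<close> made of the cost accumulated before \<open>s\<close> plus
  the sum of the local values at the states of time \<open>s\<close>. It starts at the sum of the local values of
  the initial state and ends at the total cost. So each of the two outer bounds amounts to
  monotonicity of the expectation of \<open>B\<^sub>s\<close> in \<open>s\<close>.

  \<^item> \<^bold>\<open>Lower bound.\<close> Add the price terms to the stage costs. An admissible price makes the total of
    these terms nonpositive on every admissible process, so the total cost does not increase; and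
    with them each unit satisfies its own Bellman inequality, whence the expectation of \<open>B\<^sub>s\<close>
    is nondecreasing (\<open>sum_price_value_le_total_cost\<close>).

  \<^item> \<^bold>\<open>Upper bound.\<close> Controls that are nearly optimal for each unit with the resource \<open>r\<close> are jointly
    feasible because \<open>r\<close> is admissible. The resource policy is optimal one step ahead among all
    feasible controls, so it does at least as well, whence the expectation of \<open>B\<^sub>s\<close> is
    nonincreasing along its trajectory (\<open>policy_value_le_sum_resource_value\<close>).

  \<^item> \<^bold>\<open>Middle.\<close> Trajectories of the two policies are admissible for the global problem.

  The delicate point is integrability, since only the total cost is known to have an expectation.
  If this expectation is \<open>\<infinity>\<close> in the lower bound, or \<open>-\<infinity>\<close> in the upper bound, nothing is to be
  proved. Otherwise the positive, respectively negative, part of \<open>B\<^sub>T\<close> is integrable, and running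
  the induction backwards in time carries this one-sided integrability from \<open>B\<^bsub>s+1\<^esub>\<close> to \<open>B\<^sub>s\<close>. In
  the forward direction it would be lost.
\<close>

section \<open>Expectation of extended-real functions\<close>

abbreviation pos_integral :: "'o measure \<Rightarrow> ('o \<Rightarrow> ereal) \<Rightarrow> ennreal" where
  "pos_integral M f \<equiv> \<integral>\<^sup>+\<omega>. e2ennreal (f \<omega>) \<partial>M"

abbreviation neg_integral :: "'o measure \<Rightarrow> ('o \<Rightarrow> ereal) \<Rightarrow> ennreal" where
  "neg_integral M f \<equiv> \<integral>\<^sup>+\<omega>. e2ennreal (- f \<omega>) \<partial>M"

lemma ennreal_eq_max: "ennreal y = ennreal (max 0 y)"
  by (cases "0 \<le> y") (auto simp: max_def ennreal_neg)

lemma ennreal_pos_neg_add: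
  "ennreal (a + b) + ennreal (- a) + ennreal (- b) = ennreal (- a - b) + ennreal a + ennreal b"
proof -
  have *: "ennreal x + ennreal y + ennreal z = ennreal (max 0 x + max 0 y + max 0 z)" for x y z
    by (simp flip: ennreal_eq_max)
  have "max 0 (a + b) + max 0 (- a) + max 0 (- b) = max 0 (- a - b) + max 0 a + max 0 b"
    by (auto simp: max_def)
  then show ?thesis unfolding * by (rule arg_cong)
qed

text \<open>
  The subtraction-free form of \<open>h\<^sup>+ - h\<^sup>- = f\<^sup>+ - f\<^sup>- + g\<^sup>+ - g\<^sup>-\<close> for \<open>h = f + g\<close>. In this form it
  survives infinite values, whatever their signs, and can be integrated without any assumption.
\<close>

lemma e2ennreal_add_parts:
  "e2ennreal (f + g) + e2ennreal (- f) + e2ennreal (- g) =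
   e2ennreal (- (f + g)) + e2ennreal f + e2ennreal g"
  using ennreal_pos_neg_add by (cases f; cases g) (auto simp: e2ennreal_neg)

lemma ennreal_add_le: "ennreal (a + b) \<le> ennreal a + ennreal b"
proof -
  have "ennreal (a + b) \<le> ennreal (max 0 a + max 0 b)"
    by (intro ennreal_leI) simp
  also have "\<dots> = ennreal a + ennreal b"
    by (simp flip: ennreal_eq_max)
  finally show ?thesis .
qed

lemma e2ennreal_minus_add_le: "e2ennreal (- (f + g)) \<le> e2ennreal (- f) + e2ennreal (- g)"
  using ennreal_add_le[of "- real_of_ereal f" "- real_of_ereal g"]
  by (cases f; cases g) (auto simp: e2ennreal_neg)

lemma ennreal_real_infinity_cases: obtains (real) a where "0 \<le> a" "x = ennreal a" | (inf) "x = \<infinity>"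
  by (cases x) auto

lemma neg_integral_add_finite:
  assumes [measurable]: "f \<in> borel_measurable M" "g \<in> borel_measurable M"
    and "neg_integral M f < \<infinity>" "neg_integral M g < \<infinity>"
  shows "neg_integral M (\<lambda>\<omega>. f \<omega> + g \<omega>) < \<infinity>"
proof -
  have "neg_integral M (\<lambda>\<omega>. f \<omega> + g \<omega>) \<le> (\<integral>\<^sup>+\<omega>. e2ennreal (- f \<omega>) + e2ennreal (- g \<omega>) \<partial>M)"
    by (intro nn_integral_mono e2ennreal_minus_add_le)
  also have "\<dots> = neg_integral M f + neg_integral M g"
    by (rule nn_integral_add) auto
  finally show ?thesis using assms(3,4)
    by (auto intro: le_less_trans)
qed

lemma expect_add:
  assumes [measurable]: "f \<in> borel_measurable M" "g \<in> borel_measurable M"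
    and fin: "neg_integral M f < \<infinity>" "neg_integral M g < \<infinity>"
  shows "expect M (\<lambda>\<omega>. f \<omega> + g \<omega>) = expect M f + expect M g"
proof -
  let ?h = "\<lambda>\<omega>. f \<omega> + g \<omega>"
  have "(\<integral>\<^sup>+\<omega>. e2ennreal (?h \<omega>) + e2ennreal (- f \<omega>) + e2ennreal (- g \<omega>) \<partial>M)
      = (\<integral>\<^sup>+\<omega>. e2ennreal (- ?h \<omega>) + e2ennreal (f \<omega>) + e2ennreal (g \<omega>) \<partial>M)"
    by (simp only: e2ennreal_add_parts)
  then have eq: "pos_integral M ?h + neg_integral M f + neg_integral M g = neg_integral M ?h + pos_integral M f + pos_integral M g"
    by (simp add: nn_integral_add)
  obtain a b c where "0 \<le> a" "neg_integral M f = ennreal a" "0 \<le> b" "neg_integral M g = ennreal b"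
    "0 \<le> c" "neg_integral M ?h = ennreal c"
    using fin neg_integral_add_finite[OF assms] unfolding infinity_ennreal_def less_top_ennreal
    by blast
  with eq show ?thesis
    unfolding expect_def
    by (cases "pos_integral M ?h" rule: ennreal_real_infinity_cases; cases "pos_integral M f" rule: ennreal_real_infinity_cases;
        cases "pos_integral M g" rule: ennreal_real_infinity_cases)
      (auto simp flip: ennreal_plus simp: enn2ereal_ennreal)
qed

text \<open>
  Fails if both parts have an infinite integral: the junk value \<open>\<infinity>\<close> is the same for \<open>f\<close> and \<open>- f\<close>.
\<close>

lemma expect_uminus:
  assumes "has_expect M f"
  shows "expect M (\<lambda>\<omega>. - f \<omega>) = - expect M f"
  using assms unfolding expect_def has_expect_def
  by (cases "pos_integral M f" rule: ennreal_real_infinity_cases; cases "neg_integral M f" rule: ennreal_real_infinity_cases)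
    (auto simp: enn2ereal_ennreal)

lemma has_expect_uminus: "has_expect M f \<Longrightarrow> has_expect M (\<lambda>\<omega>. - f \<omega>)"
  by (auto simp: has_expect_def)

lemma expect_mono:
  assumes "AE \<omega> in M. f \<omega> \<le> g \<omega>"
  shows "expect M f \<le> expect M g"
  unfolding expect_def using assms
  by (intro ereal_minus_mono, unfold less_eq_ennreal.rep_eq[symmetric])
    (auto intro!: nn_integral_mono_AE e2ennreal_mono elim!: eventually_mono)

lemma neg_integral_finite_iff:
  assumes "has_expect M f"
  shows "neg_integral M f < \<top> \<longleftrightarrow> expect M f \<noteq> - \<infinity>"
  using assms unfolding expect_def has_expect_def
  by (cases "pos_integral M f" rule: ennreal_real_infinity_cases; cases "neg_integral M f" rule: ennreal_real_infinity_cases)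
    (auto simp: enn2ereal_ennreal)

lemma pos_integral_finite_iff:
  assumes "has_expect M f"
  shows "pos_integral M f < \<top> \<longleftrightarrow> expect M f \<noteq> \<infinity>"
  using neg_integral_finite_iff[OF has_expect_uminus[OF assms]] expect_uminus[OF assms] by simp

lemma expect_sum:
  assumes "\<And>i. i \<in> I \<Longrightarrow> f i \<in> borel_measurable M" "\<And>i. i \<in> I \<Longrightarrow> neg_integral M (f i) < \<infinity>"
  shows "neg_integral M (\<lambda>\<omega>. \<Sum>i\<in>I. f i \<omega>) < \<infinity> \<and>
    expect M (\<lambda>\<omega>. \<Sum>i\<in>I. f i \<omega>) = (\<Sum>i\<in>I. expect M (f i))"
  using assms
proof (induction I rule: infinite_finite_induct)
  case (insert i I)
  have [measurable]: "\<And>j. j \<in> insert i I \<Longrightarrow> f j \<in> borel_measurable M"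
    using insert.prems(1) .
  have "neg_integral M (\<lambda>\<omega>. f i \<omega> + (\<Sum>i\<in>I. f i \<omega>)) < \<infinity>"
    using insert by (intro neg_integral_add_finite) auto
  moreover have "expect M (\<lambda>\<omega>. f i \<omega> + (\<Sum>i\<in>I. f i \<omega>))
      = expect M (f i) + (\<Sum>i\<in>I. expect M (f i))"
    using insert by (subst expect_add) auto
  ultimately show ?case using insert.hyps by simp
qed (auto simp: expect_def zero_ennreal.rep_eq e2ennreal_neg)

context prob_space begin

lemma expect_const: "expect M (\<lambda>_. c) = c"
  by (cases c) (auto simp: expect_def emeasure_space_1 e2ennreal_neg zero_ennreal.rep_eq 
    enn2ereal_top enn2ereal_ennreal max_def ennreal.rep_eq)

lemma expect_const_add:
  assumes f: "has_expect M f"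
  shows "expect M (\<lambda>\<omega>. ereal a + f \<omega>) = ereal a + expect M f"
proof -
  have [measurable]: "f \<in> borel_measurable M" using f by (simp add: has_expect_def)
  have pos: "expect M (\<lambda>\<omega>. ereal c + g \<omega>) = ereal c + expect M g"
    "neg_integral M (\<lambda>\<omega>. ereal c + g \<omega>) < \<infinity>"
    if "g \<in> borel_measurable M" "neg_integral M g < \<infinity>" for g c
    using that neg_integral_add_finite[of "\<lambda>_. ereal c" M g] expect_add[of "\<lambda>_. ereal c" M g]
    by (simp_all add: expect_const emeasure_space_1)
  show ?thesis
  proof (cases "neg_integral M f < \<infinity>")
    case True
    then show ?thesis by (simp add: pos)
  next
    case False
    with f have *: "neg_integral M (\<lambda>\<omega>. - f \<omega>) < \<infinity>" by (simp add: has_expect_def)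
    \<comment> \<open>The positive part is now the integrable one, so the case already treated applies to \<open>- f\<close>.\<close>
    let ?g = "\<lambda>\<omega>. ereal (- a) + - f \<omega>"
    have "has_expect M ?g" using pos(2)[OF _ *] by (simp add: has_expect_def)
    moreover have "(\<lambda>\<omega>. - ?g \<omega>) = (\<lambda>\<omega>. ereal a + f \<omega>)"
      proof
      fix \<omega> show "- ?g \<omega> = ereal a + f \<omega>" by (cases "f \<omega>") auto
    qed
    ultimately have "expect M (\<lambda>\<omega>. ereal a + f \<omega>) = - expect M ?g"
      by (metis expect_uminus)
    also have "\<dots> = - (ereal (- a) + - expect M f)"
      using pos(1)[OF _ *] expect_uminus[OF f] by simp
    also have "\<dots> = ereal a + expect M f" by (cases "expect M f") auto
    finally show ?thesis .
  qed
qed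

text \<open>
  Here \<open>a\<close> will be the cost accumulated so far, a constant once the past is frozen. If \<open>a = \<infinity>\<close>, both
  sides are \<open>\<infinity>\<close>, because \<open>\<infinity>\<close> absorbs every summand. The alternative \<open>v = - \<infinity>\<close> is there because
  a local price value may be \<open>-\<infinity>\<close>, in which case the summed integrand may lack an expectation.
\<close>

lemma le_expect_shifted:
  assumes "v \<le> expect M f" "v = - \<infinity> \<or> has_expect M f" "a \<noteq> - \<infinity>"
  shows "a + v \<le> expect M (\<lambda>\<omega>. a + f \<omega>)"
proof (cases a)
  case (real b)
  show ?thesis
  proof (cases "v = - \<infinity>")
    case False
    with assms(2) have "has_expect M f" by simp
    with real add_left_mono[OF assms(1), of a] show ?thesis by (simp add: expect_const_add)
  qed (use real in simp)
qed (use assms in \<open>auto simp: expect_const\<close>)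

lemma expect_shifted_le:
  assumes "expect M f \<le> v" "has_expect M f" "a \<noteq> - \<infinity>"
  shows "expect M (\<lambda>\<omega>. a + f \<omega>) \<le> a + v"
proof (cases a)
  case (real b)
  with assms(2) add_left_mono[OF assms(1), of a] show ?thesis by (simp add: expect_const_add)
qed (use assms in \<open>auto simp: expect_const\<close>)

end

text \<open>
  The pointwise input of the comparison below, with \<open>p\<close> and \<open>n\<close> the conditional means of the
  positive and negative parts; again all subtractions are moved to the other side, so that the
  inequality can be integrated.
\<close>

lemma parts_le_of_le_diff:
  assumes "b \<le> enn2ereal p - enn2ereal n" "p < \<infinity>"
  shows "e2ennreal b + n \<le> p + e2ennreal (- b)" "e2ennreal b \<le> p"
proof -
  obtain q where q: "p = ennreal q" "0 \<le> q" using assms(2) by (cases p rule: ennreal_real_infinity_cases) auto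
  have "e2ennreal b + n \<le> p + e2ennreal (- b) \<and> e2ennreal b \<le> p"
  proof (cases n rule: ennreal_real_infinity_cases)
    case (real m)
    show ?thesis
    proof (cases b)
      case (real c)
      have c: "c \<le> q - m" using assms q \<open>n = ennreal m\<close> \<open>0 \<le> m\<close> real by (simp add: enn2ereal_ennreal)
      have "ennreal (max 0 c + m) \<le> ennreal (q + max 0 (- c))" "ennreal (max 0 c) \<le> ennreal q"
        by (rule ennreal_leI, use c q \<open>0 \<le> m\<close> in \<open>simp add: max_def\<close>)+
      then show ?thesis
        using q real \<open>n = ennreal m\<close> \<open>0 \<le> m\<close> by (simp flip: ennreal_eq_max)
    qed (use assms q \<open>n = ennreal m\<close> \<open>0 \<le> m\<close> in \<open>auto simp: enn2ereal_ennreal e2ennreal_neg\<close>)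
  qed (use assms q in \<open>auto simp: enn2ereal_ennreal e2ennreal_neg\<close>)
  then show "e2ennreal b + n \<le> p + e2ennreal (- b)" "e2ennreal b \<le> p" by auto
qed

lemma diff_le_diff_of_parts:
  assumes "a + n \<le> p + m" "a < \<infinity>" "p < \<infinity>"
  shows "enn2ereal a - enn2ereal m \<le> enn2ereal p - enn2ereal n"
  using assms
  by (cases a rule: ennreal_real_infinity_cases; cases n rule: ennreal_real_infinity_cases; 
      cases p rule: ennreal_real_infinity_cases; cases m rule: ennreal_real_infinity_cases)
     (auto simp flip: ennreal_plus simp: enn2ereal_ennreal top_unique)

section \<open>Averaging over a variable independent of the past\<close>

context prob_space begin

text \<open>
  The past is used as a \<open>\<sigma>\<close>-algebra rather than as a random vector of past noises: controls are only
  required to be measurable for it, and a control space whose \<open>\<sigma>\<close>-algebra does not separate points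
  admits controls that are not functions of the noise.
\<close>

definition indep_of_algebra :: "'a measure \<Rightarrow> 'w measure \<Rightarrow> ('a \<Rightarrow> 'w) \<Rightarrow> bool" where
  "indep_of_algebra F N W \<longleftrightarrow> space F = space M \<and> W \<in> M \<rightarrow>\<^sub>M N \<and>
     indep_set (sets F) {W -` B \<inter> space M | B. B \<in> sets N}"

lemma distr_indep_of_algebra:
  assumes "indep_of_algebra F N W"
  shows "distr M (F \<Otimes>\<^sub>M N) (\<lambda>\<omega>. (\<omega>, W \<omega>)) = distr M F (\<lambda>\<omega>. \<omega>) \<Otimes>\<^sub>M distr M N W"
    and "(\<lambda>\<omega>. \<omega>) \<in> M \<rightarrow>\<^sub>M F"
proof -
  have W [measurable]: "W \<in> M \<rightarrow>\<^sub>M N" and F: "space F = space M"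
    and ind: "indep_set (sets F) {W -` B \<inter> space M | B. B \<in> sets N}"
    using assms by (auto simp: indep_of_algebra_def)
  show id [measurable]: "(\<lambda>\<omega>. \<omega>) \<in> M \<rightarrow>\<^sub>M F"
  proof (rule measurableI)
    fix A assume A: "A \<in> sets F"
    then have "A \<in> events" using indep_setD_ev1[OF ind] by auto
    moreover have "(\<lambda>\<omega>. \<omega>) -` A \<inter> space M = A" using sets.sets_into_space[OF A] F by auto
    ultimately show "(\<lambda>\<omega>. \<omega>) -` A \<inter> space M \<in> events" by simp
  qed (simp add: F)
  interpret F: prob_space "distr M F (\<lambda>\<omega>. \<omega>)" by (rule prob_space_distr) simp
  interpret W: prob_space "distr M N W" by (rule prob_space_distr) simp
  interpret FW: pair_sigma_finite "distr M F (\<lambda>\<omega>. \<omega>)" "distr M N W" ..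
  show "distr M (F \<Otimes>\<^sub>M N) (\<lambda>\<omega>. (\<omega>, W \<omega>)) = distr M F (\<lambda>\<omega>. \<omega>) \<Otimes>\<^sub>M distr M N W"
  proof (rule sym, rule pair_measure_eqI)
    fix A B assume "A \<in> sets (distr M F (\<lambda>\<omega>. \<omega>))" "B \<in> sets (distr M N W)"
    then have AB [measurable]: "A \<in> sets F" "B \<in> sets N" by auto
    have A: "A \<inter> space M = A" using sets.sets_into_space[OF AB(1)] F by auto
    have "(\<lambda>\<omega>. (\<omega>, W \<omega>)) -` (A \<times> B) \<inter> space M = A \<inter> (W -` B \<inter> space M)"
      using A by auto
    then have "emeasure (distr M (F \<Otimes>\<^sub>M N) (\<lambda>\<omega>. (\<omega>, W \<omega>))) (A \<times> B)
        = ennreal (prob (A \<inter> (W -` B \<inter> space M)))"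
      by (subst emeasure_distr) (auto simp: emeasure_eq_measure)
    also have "prob (A \<inter> (W -` B \<inter> space M)) = prob A * prob (W -` B \<inter> space M)"
      using AB by (intro indep_setD[OF ind]) auto
    also have "ennreal \<dots> = emeasure (distr M F (\<lambda>\<omega>. \<omega>)) A * emeasure (distr M N W) B"
      by (simp add: emeasure_distr A emeasure_eq_measure ennreal_mult)
    finally show "emeasure (distr M F (\<lambda>\<omega>. \<omega>)) A * emeasure (distr M N W) B
        = emeasure (distr M (F \<Otimes>\<^sub>M N) (\<lambda>\<omega>. (\<omega>, W \<omega>))) (A \<times> B)" by simp
  qed (auto intro: F.sigma_finite_measure_axioms W.sigma_finite_measure_axioms cong: sets_pair_measure_cong)
qed

text \<open>
  Fubini's theorem for the product law of the pair formed by the past and \<open>W\<close>, pulled back to the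
  sample space: \<open>W\<close> may be replaced by an independent copy.
\<close>

lemma nn_integral_indep_of_algebra:
  assumes indep: "indep_of_algebra F N W"
    and [measurable]: "k \<in> borel_measurable (F \<Otimes>\<^sub>M N)"
  shows "(\<integral>\<^sup>+\<omega>. k (\<omega>, W \<omega>) \<partial>M) = (\<integral>\<^sup>+\<omega>. \<integral>\<^sup>+\<omega>'. k (\<omega>, W \<omega>') \<partial>M \<partial>M)"
    and "(\<lambda>\<omega>. \<integral>\<^sup>+\<omega>'. k (\<omega>, W \<omega>') \<partial>M) \<in> borel_measurable M"
proof -
  have id [measurable]: "(\<lambda>\<omega>. \<omega>) \<in> M \<rightarrow>\<^sub>M F" and [measurable]: "W \<in> M \<rightarrow>\<^sub>M N"
    using indep distr_indep_of_algebra(2) by (auto simp: indep_of_algebra_def)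
  interpret W: prob_space "distr M N W" by (rule prob_space_distr) simp
  have sec: "(\<integral>\<^sup>+w. k (y, w) \<partial>distr M N W) = (\<integral>\<^sup>+\<omega>'. k (y, W \<omega>') \<partial>M)" if "y \<in> space F" for y
    using that by (subst nn_integral_distr) auto
  have meas: "(\<lambda>y. \<integral>\<^sup>+w. k (y, w) \<partial>distr M N W) \<in> borel_measurable F"
    by measurable
  then have meas': "(\<lambda>y. \<integral>\<^sup>+\<omega>'. k (y, W \<omega>') \<partial>M) \<in> borel_measurable F"
    by (subst measurable_cong[OF sec[symmetric]])
  then show "(\<lambda>\<omega>. \<integral>\<^sup>+\<omega>'. k (\<omega>, W \<omega>') \<partial>M) \<in> borel_measurable M"
    using measurable_compose[OF id meas'] by simp
  have "(\<integral>\<^sup>+\<omega>. k (\<omega>, W \<omega>) \<partial>M) = (\<integral>\<^sup>+z. k z \<partial>distr M (F \<Otimes>\<^sub>M N) (\<lambda>\<omega>. (\<omega>, W \<omega>)))"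
    by (subst nn_integral_distr) auto
  also have "\<dots> = (\<integral>\<^sup>+y. \<integral>\<^sup>+w. k (y, w) \<partial>distr M N W \<partial>distr M F (\<lambda>\<omega>. \<omega>))"
    unfolding distr_indep_of_algebra(1)[OF indep] by (subst W.nn_integral_fst) auto
  also have "\<dots> = (\<integral>\<^sup>+y. \<integral>\<^sup>+\<omega>'. k (y, W \<omega>') \<partial>M \<partial>distr M F (\<lambda>\<omega>. \<omega>))"
    by (intro nn_integral_cong sec) simp
  also have "\<dots> = (\<integral>\<^sup>+\<omega>. \<integral>\<^sup>+\<omega>'. k (\<omega>, W \<omega>') \<partial>M \<partial>M)"
    using meas' by (subst nn_integral_distr) auto
  finally show "(\<integral>\<^sup>+\<omega>. k (\<omega>, W \<omega>) \<partial>M) = (\<integral>\<^sup>+\<omega>. \<integral>\<^sup>+\<omega>'. k (\<omega>, W \<omega>') \<partial>M \<partial>M)" .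
qed

text \<open>
  Integrability of the positive part makes \<open>p\<close> finite almost everywhere. Then the assumption on \<open>b\<close>
  can be written with sums of nonnegative functions, whose integrals are given by Fubini's theorem.
\<close>

lemma expect_ge_of_conditional_ge:
  assumes indep: "indep_of_algebra F N W"
    and h [measurable]: "h \<in> borel_measurable (F \<Otimes>\<^sub>M N)"
    and b [measurable]: "b \<in> borel_measurable M"
    and le: "\<And>\<omega>. \<omega> \<in> space M \<Longrightarrow> b \<omega> \<le> expect M (\<lambda>\<omega>'. h (\<omega>, W \<omega>'))"
    and fin: "pos_integral M (\<lambda>\<omega>. h (\<omega>, W \<omega>)) < \<infinity>"
  shows "pos_integral M b < \<infinity>" "expect M b \<le> expect M (\<lambda>\<omega>. h (\<omega>, W \<omega>))"
proof -
  let ?H = "\<lambda>\<omega>. h (\<omega>, W \<omega>)"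
  let ?p = "\<lambda>\<omega>. pos_integral M (\<lambda>\<omega>'. h (\<omega>, W \<omega>'))" and ?n = "\<lambda>\<omega>. neg_integral M (\<lambda>\<omega>'. h (\<omega>, W \<omega>'))"
  note p = nn_integral_indep_of_algebra[OF indep, of "\<lambda>z. e2ennreal (h z)", simplified]
    and n = nn_integral_indep_of_algebra[OF indep, of "\<lambda>z. e2ennreal (- h z)", simplified]
  have [measurable]: "?p \<in> borel_measurable M" "?n \<in> borel_measurable M"
    using p(2) n(2) by auto
  have "AE \<omega> in M. ?p \<omega> \<noteq> \<infinity>"
    using fin p(1) by (intro nn_integral_PInf_AE) auto
  then have parts: "AE \<omega> in M. e2ennreal (b \<omega>) + ?n \<omega> \<le> ?p \<omega> + e2ennreal (- b \<omega>) \<and>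
      e2ennreal (b \<omega>) \<le> ?p \<omega>"
  proof (rule AE_mp, intro AE_I2 impI)
    fix \<omega> assume "\<omega> \<in> space M" "?p \<omega> \<noteq> \<infinity>"
    then show "e2ennreal (b \<omega>) + ?n \<omega> \<le> ?p \<omega> + e2ennreal (- b \<omega>) \<and> e2ennreal (b \<omega>) \<le> ?p \<omega>"
      using parts_le_of_le_diff[OF le[unfolded expect_def]] by (simp add: less_top)
  qed
  then have "pos_integral M b \<le> integral\<^sup>N M ?p"
    by (intro nn_integral_mono_AE) auto
  with fin show b_fin: "pos_integral M b < \<infinity>"
    using p(1) by (auto intro: le_less_trans)
  have "(\<integral>\<^sup>+\<omega>. e2ennreal (b \<omega>) + ?n \<omega> \<partial>M) \<le> (\<integral>\<^sup>+\<omega>. ?p \<omega> + e2ennreal (- b \<omega>) \<partial>M)"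
    using parts by (intro nn_integral_mono_AE) auto
  then have "pos_integral M b + neg_integral M ?H \<le> pos_integral M ?H + neg_integral M b"
    using p(1) n(1) by (simp add: nn_integral_add)
  then show "expect M b \<le> expect M ?H"
    unfolding expect_def using b_fin fin by (rule diff_le_diff_of_parts)
qed

lemma expect_le_of_conditional_le:
  assumes indep: "indep_of_algebra F N W"
    and h [measurable]: "h \<in> borel_measurable (F \<Otimes>\<^sub>M N)"
    and b [measurable]: "b \<in> borel_measurable M"
    and le: "\<And>\<omega>. \<omega> \<in> space M \<Longrightarrow> expect M (\<lambda>\<omega>'. h (\<omega>, W \<omega>')) \<le> b \<omega>"
    and fin: "neg_integral M (\<lambda>\<omega>. h (\<omega>, W \<omega>)) < \<infinity>"
  shows "neg_integral M b < \<infinity>" "expect M (\<lambda>\<omega>. h (\<omega>, W \<omega>)) \<le> expect M b"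
proof -
  let ?H = "\<lambda>\<omega>. h (\<omega>, W \<omega>)"
  let ?p = "\<lambda>\<omega>. pos_integral M (\<lambda>\<omega>'. h (\<omega>, W \<omega>'))" and ?n = "\<lambda>\<omega>. neg_integral M (\<lambda>\<omega>'. h (\<omega>, W \<omega>'))"
  note p = nn_integral_indep_of_algebra[OF indep, of "\<lambda>z. e2ennreal (h z)", simplified]
    and n = nn_integral_indep_of_algebra[OF indep, of "\<lambda>z. e2ennreal (- h z)", simplified]
  have [measurable]: "?p \<in> borel_measurable M" "?n \<in> borel_measurable M"
    using p(2) n(2) by auto
  have "AE \<omega> in M. ?n \<omega> \<noteq> \<infinity>"
    using fin n(1) by (intro nn_integral_PInf_AE) auto
  then have parts: "AE \<omega> in M. e2ennreal (- b \<omega>) + ?p \<omega> \<le> ?n \<omega> + e2ennreal (b \<omega>) \<and>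
      e2ennreal (- b \<omega>) \<le> ?n \<omega>"
  proof (rule AE_mp, intro AE_I2 impI)
    fix \<omega> assume \<omega>: "\<omega> \<in> space M" "?n \<omega> \<noteq> \<infinity>"
    then have "- b \<omega> \<le> enn2ereal (?n \<omega>) - enn2ereal (?p \<omega>)"
      using le[unfolded expect_def, of \<omega>]
      by (cases "?n \<omega>" rule: ennreal_real_infinity_cases; cases "?p \<omega>" rule: ennreal_real_infinity_cases; cases "b \<omega>")
        (auto simp: enn2ereal_ennreal)
    from parts_le_of_le_diff[OF this] \<omega>(2)
    show "e2ennreal (- b \<omega>) + ?p \<omega> \<le> ?n \<omega> + e2ennreal (b \<omega>) \<and> e2ennreal (- b \<omega>) \<le> ?n \<omega>"
      by (simp add: less_top)
  qed
  then have "neg_integral M b \<le> integral\<^sup>N M ?n"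
    by (intro nn_integral_mono_AE) auto
  with fin show b_fin: "neg_integral M b < \<infinity>"
    using n(1) by (auto intro: le_less_trans)
  have "(\<integral>\<^sup>+\<omega>. e2ennreal (- b \<omega>) + ?p \<omega> \<partial>M) \<le> (\<integral>\<^sup>+\<omega>. ?n \<omega> + e2ennreal (b \<omega>) \<partial>M)"
    using parts by (intro nn_integral_mono_AE) auto
  then have "neg_integral M b + pos_integral M ?H \<le> neg_integral M ?H + pos_integral M b"
    using p(1) n(1) by (simp add: nn_integral_add)
  then have "neg_integral M b + pos_integral M ?H \<le> pos_integral M b + neg_integral M ?H"
    by (simp add: ac_simps)
  then show "expect M ?H \<le> expect M b"
    unfolding expect_def using b_fin fin
    by (cases "pos_integral M b" rule: ennreal_real_infinity_cases; cases "pos_integral M ?H" rule: ennreal_real_infinity_cases;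
        cases "neg_integral M b" rule: ennreal_real_infinity_cases; cases "neg_integral M ?H" rule: ennreal_real_infinity_cases)
      (auto simp flip: ennreal_plus simp: enn2ereal_ennreal top_unique)
qed

end

section \<open>The information generated by the noise\<close>

lemma space_noise_filtration [simp]: "space (noise_filtration D s) = space (prob_sp D)"
  unfolding noise_filtration_def by (intro space_measure_of) auto

lemma sets_noise_filtration:
  "sets (noise_filtration D s) = sigma_sets (space (prob_sp D))
     (\<Union>s\<in>{1..s}. {global_noise D s -` A \<inter> space (prob_sp D) | A. A \<in> sets (global_noise_sp D s)})"
  unfolding noise_filtration_def by (intro sets_measure_of) auto

lemma global_noise_measurable_noise_filtration:
  assumes "1 \<le> s" "s \<le> s'" "\<And>\<omega>. \<omega> \<in> space (prob_sp D) \<Longrightarrow> global_noise D s \<omega> \<in> space (global_noise_sp D s)"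
  shows "global_noise D s \<in> noise_filtration D s' \<rightarrow>\<^sub>M global_noise_sp D s"
  using assms by (intro measurableI) (auto simp: sets_noise_filtration intro!: sigma_sets.Basic bexI[of _ s] exI)

lemma noise_filtration_mono: "s \<le> s' \<Longrightarrow> sets (noise_filtration D s) \<subseteq> sets (noise_filtration D s')"
  unfolding sets_noise_filtration by (intro sigma_sets_mono') force

lemma measurable_noise_filtration_mono:
  assumes "f \<in> noise_filtration D s \<rightarrow>\<^sub>M N" "s \<le> s'"
  shows "f \<in> noise_filtration D s' \<rightarrow>\<^sub>M N"
  using assms noise_filtration_mono[of s s' D] by (auto simp: measurable_def)

text \<open>
  The past up to \<open>s\<close> and the noise at \<open>s + 1\<close> are generated by disjoint blocks of the independent
  family of noises.
\<close>

lemma indep_noise_filtration: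
  assumes M: "prob_space (prob_sp D)"
    and indep: "prob_space.indep_vars (prob_sp D) (global_noise_sp D) (global_noise D) {1..horizon D}"
    and s: "s < horizon D"
  shows "prob_space.indep_of_algebra (prob_sp D) (noise_filtration D s)
    (global_noise_sp D (Suc s)) (global_noise D (Suc s))"
proof -
  interpret prob_space "prob_sp D" by fact
  let ?M = "prob_sp D"
  let ?E = "\<lambda>s. {global_noise D s -` A \<inter> space ?M | A. A \<in> sets (global_noise_sp D s)}"
  let ?I = "\<lambda>b. if b then {1..s} else {Suc s}"
  have rv: "\<And>k. k \<in> {1..horizon D} \<Longrightarrow> global_noise D k \<in> ?M \<rightarrow>\<^sub>M global_noise_sp D k"
    and E: "indep_sets ?E {1..horizon D}"
    using indep by (auto simp: indep_vars_def2)
  have stable: "Int_stable (?E k)" for k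
  proof (rule Int_stableI)
    fix a b assume "a \<in> ?E k" "b \<in> ?E k"
    then obtain A B where "A \<in> sets (global_noise_sp D k)" "B \<in> sets (global_noise_sp D k)"
      "a = global_noise D k -` A \<inter> space ?M" "b = global_noise D k -` B \<inter> space ?M" by auto
    then show "a \<inter> b \<in> ?E k" by (intro CollectI exI[of _ "A \<inter> B"]) auto
  qed
  have "indep_sets (\<lambda>b. sigma_sets (space ?M) (\<Union>k\<in>?I b. ?E k)) (UNIV :: bool set)"
  proof (rule indep_sets_collect_sigma)
    show "indep_sets ?E (\<Union>b\<in>UNIV. ?I b)"
      using s by (intro indep_sets_mono_index[OF _ E]) (auto split: if_splits)
  qed (auto simp: stable disjoint_family_on_def)
  then have "indep_set (sets (noise_filtration D s)) (sigma_sets (space ?M) (?E (Suc s)))"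
    unfolding indep_set_def sets_noise_filtration
    by (rule iffD1[OF indep_sets_cong, rotated -1]) (auto split: bool.split)
  then have "indep_set (sets (noise_filtration D s)) (?E (Suc s))"
    unfolding indep_set_def
    by (rule indep_sets_mono_sets) (auto split: bool.split intro: sigma_sets.Basic)
  with rv[of "Suc s"] s show ?thesis
    by (simp add: indep_of_algebra_def)
qed

lemma measurable_uncurried3:
  assumes "(\<lambda>(x, u, w). f x u w) \<in> A \<Otimes>\<^sub>M B \<Otimes>\<^sub>M C \<rightarrow>\<^sub>M N"
    and "X \<in> L \<rightarrow>\<^sub>M A" "U \<in> L \<rightarrow>\<^sub>M B" "W \<in> L \<rightarrow>\<^sub>M C"
  shows "(\<lambda>\<omega>. f (X \<omega>) (U \<omega>) (W \<omega>)) \<in> L \<rightarrow>\<^sub>M N"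
  using measurable_compose[OF measurable_Pair[OF assms(2) measurable_Pair[OF assms(3,4)]] assms(1)]
  by simp

locale independent_noise =
  fixes D :: "('i, 'x, 'u, 'w, 'r::real_vector, 'p::real_vector, 'o) multistage"
  assumes wp: "well_posed D"
    and indep: "prob_space.indep_vars (prob_sp D) (global_noise_sp D) (global_noise D) {1..horizon D}"
begin

abbreviation "M \<equiv> prob_sp D"
abbreviation "T \<equiv> horizon D"
abbreviation "I \<equiv> units D"

sublocale prob_space M using wp by (simp add: well_posed_def)

lemma finite_units [simp]: "finite I"
  using wp by (simp add: well_posed_def)

lemma noise_measurable: "s < T \<Longrightarrow> i \<in> I \<Longrightarrow> noise D (Suc s) i \<in> M \<rightarrow>\<^sub>M noise_sp D (Suc s) i"
  using wp by (auto simp: well_posed_def)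

lemma dyn_measurable:
  assumes "s < T" "i \<in> I"
  shows "(\<lambda>(x, u, w). dyn D s i x u w) \<in>
    state_sp D s i \<Otimes>\<^sub>M control_sp D s i \<Otimes>\<^sub>M noise_sp D (Suc s) i \<rightarrow>\<^sub>M state_sp D (Suc s) i"
  using wp assms by (auto simp: well_posed_def)

lemma global_noise_in_space:
  "s < T \<Longrightarrow> \<omega> \<in> space M \<Longrightarrow> global_noise D (Suc s) \<omega> \<in> space (global_noise_sp D (Suc s))"
  using noise_measurable[THEN measurable_space]
  by (auto simp: global_noise_def global_noise_sp_def space_PiM)

lemma noise_adapted:
  assumes "s < T" "i \<in> I"
  shows "noise D (Suc s) i \<in> noise_filtration D (Suc s) \<rightarrow>\<^sub>M noise_sp D (Suc s) i"
proof -
  have "global_noise D (Suc s) \<in> noise_filtration D (Suc s) \<rightarrow>\<^sub>M global_noise_sp D (Suc s)"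
    using assms global_noise_in_space by (intro global_noise_measurable_noise_filtration) auto
  then have "(\<lambda>\<omega>. global_noise D (Suc s) \<omega> i) \<in> noise_filtration D (Suc s) \<rightarrow>\<^sub>M noise_sp D (Suc s) i"
    using assms by (auto simp: global_noise_sp_def intro: measurable_compose measurable_component_singleton)
  then show ?thesis using assms by (simp add: global_noise_def)
qed

lemma indep_present_noise:
  "s < T \<Longrightarrow> indep_of_algebra (noise_filtration D s) (global_noise_sp D (Suc s)) (global_noise D (Suc s))"
  using indep_noise_filtration[OF prob_space_axioms indep] .

lemma adapted_measurable:
  assumes "f \<in> noise_filtration D s \<rightarrow>\<^sub>M N" "s \<le> T"
  shows "f \<in> M \<rightarrow>\<^sub>M N"
proof -
  have "sets (noise_filtration D s) \<subseteq> events"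
    unfolding sets_noise_filtration
  proof (rule sets.sigma_sets_subset, safe)
    fix k A assume "k \<in> {1..s}" "A \<in> sets (global_noise_sp D k)"
    then show "global_noise D k -` A \<inter> space M \<in> events"
      using indep \<open>s \<le> T\<close> by (auto simp: indep_vars_def intro: measurable_sets)
  qed
  then show ?thesis using assms by (auto simp: measurable_def)
qed

end

section \<open>Dynamic programming along an adapted trajectory\<close>

lemma sum_ereal_neq_MInfty:
  assumes "\<And>i. i \<in> I \<Longrightarrow> f i \<noteq> (- \<infinity> :: ereal)"
  shows "(\<Sum>i\<in>I. f i) \<noteq> - \<infinity>"
  using assms by (induction I rule: infinite_finite_induct) auto

text \<open>
  What remains of admissibility when the coupling constraint is dropped. The constraint enters only
  through the one-step inequalities and the sign of the price terms, so dynamic programming is done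
  for these trajectories.
\<close>

definition adapted_trajectory ::
  "('i, 'x, 'u, 'w, 'r, 'p, 'o) multistage \<Rightarrow> nat \<Rightarrow> ('i \<Rightarrow> 'x) \<Rightarrow>
   (nat \<Rightarrow> 'i \<Rightarrow> 'o \<Rightarrow> 'x) \<Rightarrow> (nat \<Rightarrow> 'i \<Rightarrow> 'o \<Rightarrow> 'u) \<Rightarrow> bool" where
  "adapted_trajectory D t x X U \<longleftrightarrow>
     (\<forall>i\<in>units D. \<forall>\<omega>\<in>space (prob_sp D). X t i \<omega> = x i) \<and>
     (\<forall>s\<in>{t..<horizon D}. \<forall>i\<in>units D.
        (\<forall>\<omega>\<in>space (prob_sp D).
           X (Suc s) i \<omega> = dyn D s i (X s i \<omega>) (U s i \<omega>) (noise D (Suc s) i \<omega>)) \<and>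
        U s i \<in> noise_filtration D s \<rightarrow>\<^sub>M control_sp D s i)"

text \<open>
  Stage costs \<open>c\<close> and values \<open>V\<close> are left open: the lower bound needs stage costs with prices and the
  price values, the upper bound plain stage costs and the resource values.
\<close>

locale dynamic_programming = independent_noise D
  for D :: "('i, 'x, 'u, 'w, 'r::real_vector, 'p::real_vector, 'o) multistage" +
  fixes t :: nat and x :: "'i \<Rightarrow> 'x"
    and X :: "nat \<Rightarrow> 'i \<Rightarrow> 'o \<Rightarrow> 'x" and U :: "nat \<Rightarrow> 'i \<Rightarrow> 'o \<Rightarrow> 'u"
    and c :: "nat \<Rightarrow> 'i \<Rightarrow> 'x \<Rightarrow> 'u \<Rightarrow> 'w \<Rightarrow> ereal" and V :: "nat \<Rightarrow> 'i \<Rightarrow> 'x \<Rightarrow> ereal"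
  assumes start: "t < horizon D" "x \<in> space (global_state_sp D t)"
    and trajectory: "adapted_trajectory D t x X U"
    and c_measurable: "\<And>s i. s < horizon D \<Longrightarrow> i \<in> units D \<Longrightarrow> (\<lambda>(x, u, w). c s i x u w)
      \<in> borel_measurable (state_sp D s i \<Otimes>\<^sub>M control_sp D s i \<Otimes>\<^sub>M noise_sp D (Suc s) i)"
    and c_neq_MInfty: "\<And>s i x u w. s < horizon D \<Longrightarrow> i \<in> units D \<Longrightarrow> x \<in> space (state_sp D s i) \<Longrightarrow>
      u \<in> space (control_sp D s i) \<Longrightarrow> w \<in> space (noise_sp D (Suc s) i) \<Longrightarrow> c s i x u w \<noteq> - \<infinity>"
    and V_measurable: "\<And>s i. s \<in> {1..horizon D} \<Longrightarrow> i \<in> units D \<Longrightarrow>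
      V s i \<in> borel_measurable (state_sp D s i)"
begin

lemma control_adapted:
  "t \<le> s \<Longrightarrow> s < T \<Longrightarrow> i \<in> I \<Longrightarrow> U s i \<in> noise_filtration D s \<rightarrow>\<^sub>M control_sp D s i"
  using trajectory by (auto simp: adapted_trajectory_def)

lemma state_start: "i \<in> I \<Longrightarrow> \<omega> \<in> space M \<Longrightarrow> X t i \<omega> = x i"
  using trajectory by (auto simp: adapted_trajectory_def)

lemma state_step:
  "t \<le> s \<Longrightarrow> s < T \<Longrightarrow> i \<in> I \<Longrightarrow> \<omega> \<in> space M \<Longrightarrow>
   X (Suc s) i \<omega> = dyn D s i (X s i \<omega>) (U s i \<omega>) (noise D (Suc s) i \<omega>)"
  using trajectory by (auto simp: adapted_trajectory_def)

lemma state_adapted: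
  assumes "t \<le> s" "s \<le> T" "i \<in> I"
  shows "X s i \<in> noise_filtration D s \<rightarrow>\<^sub>M state_sp D s i"
  using assms(1,2)
proof (induction s rule: dec_induct)
  case base
  have "(\<lambda>_. x i) \<in> noise_filtration D t \<rightarrow>\<^sub>M state_sp D t i"
    using start(2) \<open>i \<in> I\<close>
    by (intro measurable_const) (auto simp: global_state_sp_def space_PiM PiE_mem)
  then show ?case using state_start[OF \<open>i \<in> I\<close>] by (subst measurable_cong) auto
next
  case (step s)
  have "X s i \<in> noise_filtration D (Suc s) \<rightarrow>\<^sub>M state_sp D s i"
    using step.IH step.prems by (auto intro: measurable_noise_filtration_mono[where s=s])
  moreover have "U s i \<in> noise_filtration D (Suc s) \<rightarrow>\<^sub>M control_sp D s i"
    using step.hyps step.prems \<open>i \<in> I\<close>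
    by (intro measurable_noise_filtration_mono[OF control_adapted]) auto
  ultimately have "(\<lambda>\<omega>. dyn D s i (X s i \<omega>) (U s i \<omega>) (noise D (Suc s) i \<omega>))
      \<in> noise_filtration D (Suc s) \<rightarrow>\<^sub>M state_sp D (Suc s) i"
    using step.prems \<open>i \<in> I\<close>
    by (intro measurable_uncurried3[OF dyn_measurable] noise_adapted) auto
  then show ?case using state_step step \<open>i \<in> I\<close> by (subst measurable_cong) auto
qed

lemma in_spaces:
  assumes "t \<le> s" "s < T" "i \<in> I" "\<omega> \<in> space M"
  shows "X s i \<omega> \<in> space (state_sp D s i)" "U s i \<omega> \<in> space (control_sp D s i)"
    "noise D (Suc s) i \<omega> \<in> space (noise_sp D (Suc s) i)"
  using assms state_adapted[THEN measurable_space, of s i \<omega>] control_adapted[THEN measurable_space]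
    noise_measurable[THEN measurable_space] by auto

definition accumulated_cost :: "nat \<Rightarrow> 'o \<Rightarrow> ereal" where
  "accumulated_cost s \<omega> =
     (\<Sum>s'=t..<s. \<Sum>i\<in>I. c s' i (X s' i \<omega>) (U s' i \<omega>) (noise D (Suc s') i \<omega>))"

definition value_to_go :: "nat \<Rightarrow> 'o \<Rightarrow> ereal" where
  "value_to_go s \<omega> = (\<Sum>i\<in>I. V s i (X s i \<omega>))"

text \<open>
  The process \<open>B\<close> of the introduction.
\<close>

definition running_value :: "nat \<Rightarrow> 'o \<Rightarrow> ereal" where
  "running_value s \<omega> = accumulated_cost s \<omega> + value_to_go s \<omega>"

text \<open>
  The function of \<open>w\<close> whose average over the noise at \<open>s + 1\<close>, the past being frozen, enters the Bellman
  recursion.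
\<close>

definition next_value :: "nat \<Rightarrow> 'o \<Rightarrow> ('i \<Rightarrow> 'w) \<Rightarrow> ereal" where
  "next_value s \<omega> w =
     (\<Sum>i\<in>I. c s i (X s i \<omega>) (U s i \<omega>) (w i) + V (Suc s) i (dyn D s i (X s i \<omega>) (U s i \<omega>) (w i)))"

lemma accumulated_cost_adapted:
  assumes "t \<le> s" "s \<le> T"
  shows "accumulated_cost s \<in> borel_measurable (noise_filtration D s)"
  unfolding accumulated_cost_def
proof (intro borel_measurable_ereal_sum)
  fix s' i assume s': "s' \<in> {t..<s}" and i: "i \<in> I"
  have "noise D (Suc s') i \<in> noise_filtration D s \<rightarrow>\<^sub>M noise_sp D (Suc s') i"
    using s' assms i by (intro measurable_noise_filtration_mono[OF noise_adapted]) auto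
  moreover have "X s' i \<in> noise_filtration D s \<rightarrow>\<^sub>M state_sp D s' i"
    using s' assms i by (intro measurable_noise_filtration_mono[OF state_adapted]) auto
  moreover have "U s' i \<in> noise_filtration D s \<rightarrow>\<^sub>M control_sp D s' i"
    using s' assms i by (intro measurable_noise_filtration_mono[OF control_adapted]) auto
  ultimately show "(\<lambda>\<omega>. c s' i (X s' i \<omega>) (U s' i \<omega>) (noise D (Suc s') i \<omega>))
      \<in> borel_measurable (noise_filtration D s)"
    using s' assms i by (intro measurable_uncurried3[OF c_measurable]) auto
qed

lemma accumulated_cost_neq_MInfty:
  assumes "s \<le> T" "\<omega> \<in> space M"
  shows "accumulated_cost s \<omega> \<noteq> - \<infinity>"
  unfolding accumulated_cost_def using assms
  by (intro sum_ereal_neq_MInfty c_neq_MInfty in_spaces) auto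

lemma next_value_measurable:
  assumes "t \<le> s" "s < T"
  shows "(\<lambda>(\<omega>, w). accumulated_cost s \<omega> + next_value s \<omega> w)
    \<in> borel_measurable (noise_filtration D s \<Otimes>\<^sub>M global_noise_sp D (Suc s))"
proof -
  let ?N = "noise_filtration D s \<Otimes>\<^sub>M global_noise_sp D (Suc s)"
  have *: "(\<lambda>z. X s i (fst z)) \<in> ?N \<rightarrow>\<^sub>M state_sp D s i"
    "(\<lambda>z. U s i (fst z)) \<in> ?N \<rightarrow>\<^sub>M control_sp D s i"
    "(\<lambda>z. snd z i) \<in> ?N \<rightarrow>\<^sub>M noise_sp D (Suc s) i" if "i \<in> I" for i
    using assms that state_adapted[of s i] control_adapted[of s i]
    by (auto simp: global_noise_sp_def intro: measurable_compose[OF measurable_fst]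
        measurable_compose[OF measurable_snd] measurable_component_singleton)
  have [measurable]: "(\<lambda>z. accumulated_cost s (fst z)) \<in> borel_measurable ?N"
    using assms accumulated_cost_adapted[of s] by (auto intro: measurable_compose[OF measurable_fst])
  have [measurable]: "(\<lambda>z. c s i (X s i (fst z)) (U s i (fst z)) (snd z i)) \<in> borel_measurable ?N"
    if "i \<in> I" for i
    using assms that by (intro measurable_uncurried3[OF c_measurable] *) auto
  have [measurable]: "(\<lambda>z. V (Suc s) i (dyn D s i (X s i (fst z)) (U s i (fst z)) (snd z i)))
      \<in> borel_measurable ?N" if "i \<in> I" for i
    using assms that
    by (intro measurable_compose[OF measurable_uncurried3[OF dyn_measurable] V_measurable] *) auto
  show ?thesis unfolding next_value_def split_beta by measurable
qed

lemma running_value_Suc: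
  assumes "t \<le> s" "s < T" "\<omega> \<in> space M"
  shows "running_value (Suc s) \<omega> = accumulated_cost s \<omega> + next_value s \<omega> (global_noise D (Suc s) \<omega>)"
  using assms
  by (simp add: running_value_def accumulated_cost_def value_to_go_def next_value_def
      global_noise_def sum.distrib state_step add.assoc)

lemma running_value_start:
  "\<omega> \<in> space M \<Longrightarrow> running_value t \<omega> = (\<Sum>i\<in>I. V t i (x i))"
  by (simp add: running_value_def accumulated_cost_def value_to_go_def state_start)

lemma expect_running_value_start: "expect M (running_value t) = (\<Sum>i\<in>I. V t i (x i))"
proof -
  have "expect M (running_value t) = expect M (\<lambda>_. \<Sum>i\<in>I. V t i (x i))"
    by (intro antisym expect_mono AE_I2) (auto simp: running_value_start)
  then show ?thesis by (simp add: expect_const)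
qed

text \<open>
  The initial time is treated apart because \<open>V 0\<close> may fail to be measurable; but there the state is
  deterministic.
\<close>

lemma running_value_measurable:
  assumes "t \<le> s" "s \<le> T"
  shows "running_value s \<in> borel_measurable M"
proof (cases "s = t")
  case True
  have "running_value t \<in> borel_measurable M \<longleftrightarrow> (\<lambda>_. \<Sum>i\<in>I. V t i (x i)) \<in> borel_measurable M"
    by (intro measurable_cong running_value_start)
  with True show ?thesis by simp
next
  case False
  have [measurable]: "(\<lambda>\<omega>. V s i (X s i \<omega>)) \<in> borel_measurable M" if "i \<in> I" for i
    using assms False that state_adapted[of s i]
    by (intro measurable_compose[OF adapted_measurable V_measurable]) auto
  have [measurable]: "accumulated_cost s \<in> borel_measurable M"
    using adapted_measurable accumulated_cost_adapted assms by auto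
  show ?thesis unfolding running_value_def value_to_go_def by measurable
qed

text \<open>
  Adding the accumulated cost, known at time \<open>s\<close>, turns the one-step inequality into a bound of
  \<open>running_value s\<close> by the conditional mean of \<open>running_value (Suc s)\<close>. The comparison lemma needs an
  integrable positive part and hands one on to the previous time, so the induction goes backwards.
\<close>

lemma expect_terminal_ge:
  assumes step: "\<And>s \<omega>. t \<le> s \<Longrightarrow> s < T \<Longrightarrow> \<omega> \<in> space M \<Longrightarrow>
      value_to_go s \<omega> \<le> expect M (\<lambda>\<omega>'. next_value s \<omega> (global_noise D (Suc s) \<omega>'))"
    and well_def: "\<And>s \<omega>. t \<le> s \<Longrightarrow> s < T \<Longrightarrow> \<omega> \<in> space M \<Longrightarrow> value_to_go s \<omega> \<noteq> - \<infinity> \<Longrightarrow>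
      has_expect M (\<lambda>\<omega>'. next_value s \<omega> (global_noise D (Suc s) \<omega>'))"
    and fin: "pos_integral M (running_value T) < \<infinity>"
  shows "(\<Sum>i\<in>I. V t i (x i)) \<le> expect M (running_value T)"
proof -
  have "pos_integral M (running_value s) < \<infinity> \<and>
      expect M (running_value s) \<le> expect M (running_value T)" if "s \<le> T" "t \<le> s" for s
    using that
  proof (induction s rule: inc_induct)
    case (step s)
    let ?h = "\<lambda>(\<omega>, w). accumulated_cost s \<omega> + next_value s \<omega> w"
    let ?H = "\<lambda>\<omega>. ?h (\<omega>, global_noise D (Suc s) \<omega>)"
    have s: "t \<le> s" "s < T" using step by auto
    have "pos_integral M ?H = pos_integral M (running_value (Suc s))"
      by (intro nn_integral_cong) (simp add: running_value_Suc s)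
    moreover have "expect M ?H = expect M (running_value (Suc s))"
      by (intro antisym expect_mono AE_I2) (auto simp: running_value_Suc s)
    moreover have "running_value s \<omega> \<le> expect M (\<lambda>\<omega>'. ?h (\<omega>, global_noise D (Suc s) \<omega>'))"
      if "\<omega> \<in> space M" for \<omega>
      unfolding running_value_def prod.case
      using assms(1,2)[OF s that] that s
      by (intro le_expect_shifted accumulated_cost_neq_MInfty) auto
    note expect_ge_of_conditional_ge[OF indep_present_noise[OF s(2)] next_value_measurable[OF s]
        running_value_measurable this]
    ultimately show ?case using step.IH s by (auto intro: order_trans)
  qed (use fin in simp)
  from this[of t] show ?thesis using start(1) by (simp add: expect_running_value_start)
qed

text \<open>
  The counterpart for upper bounds. Going backwards matters here: from a bound on
  the conditional mean of \<open>running_value (Suc s)\<close> by \<open>running_value s\<close>, integrability of the positive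
  part cannot be passed from \<open>s\<close> to \<open>s + 1\<close>, while that of the negative part passes from \<open>s + 1\<close> to \<open>s\<close>.
\<close>

lemma expect_terminal_le:
  assumes step: "\<And>s \<omega>. t \<le> s \<Longrightarrow> s < T \<Longrightarrow> \<omega> \<in> space M \<Longrightarrow>
      expect M (\<lambda>\<omega>'. next_value s \<omega> (global_noise D (Suc s) \<omega>')) \<le> value_to_go s \<omega>"
    and well_def: "\<And>s \<omega>. t \<le> s \<Longrightarrow> s < T \<Longrightarrow> \<omega> \<in> space M \<Longrightarrow>
      has_expect M (\<lambda>\<omega>'. next_value s \<omega> (global_noise D (Suc s) \<omega>'))"
    and fin: "neg_integral M (running_value T) < \<infinity>"
  shows "expect M (running_value T) \<le> (\<Sum>i\<in>I. V t i (x i))"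
proof -
  have "neg_integral M (running_value s) < \<infinity> \<and>
      expect M (running_value T) \<le> expect M (running_value s)" if "s \<le> T" "t \<le> s" for s
    using that
  proof (induction s rule: inc_induct)
    case (step s)
    let ?h = "\<lambda>(\<omega>, w). accumulated_cost s \<omega> + next_value s \<omega> w"
    let ?H = "\<lambda>\<omega>. ?h (\<omega>, global_noise D (Suc s) \<omega>)"
    have s: "t \<le> s" "s < T" using step by auto
    have "neg_integral M ?H = neg_integral M (running_value (Suc s))"
      by (intro nn_integral_cong) (simp add: running_value_Suc s)
    moreover have "expect M ?H = expect M (running_value (Suc s))"
      by (intro antisym expect_mono AE_I2) (auto simp: running_value_Suc s)
    moreover have "expect M (\<lambda>\<omega>'. ?h (\<omega>, global_noise D (Suc s) \<omega>')) \<le> running_value s \<omega>"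
      if "\<omega> \<in> space M" for \<omega>
      unfolding running_value_def prod.case
      using assms(1,2)[OF s that] that s
      by (intro expect_shifted_le accumulated_cost_neq_MInfty) auto
    note expect_le_of_conditional_le[OF indep_present_noise[OF s(2)] next_value_measurable[OF s]
        running_value_measurable this]
    ultimately show ?case using step.IH s by (auto intro: order_trans)
  qed (use fin in simp)
  from this[of t] show ?thesis using start(1) by (simp add: expect_running_value_start)
qed

end

section \<open>Lower bound by the price value functions\<close>

lemma admissible_iff_adapted_trajectory:
  "(X, U) \<in> admissible_processes D t x \<longleftrightarrow> adapted_trajectory D t x X U \<and>
     (\<forall>s\<in>{t..<horizon D}. AE \<omega> in prob_sp D.
        (\<lambda>i\<in>units D. resource D s i (X s i \<omega>) (U s i \<omega>)) \<in> neg_coupling D s)"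
  by (simp add: admissible_processes_def adapted_trajectory_def)

lemma has_expect_total_cost:
  assumes "expectations_well_defined D p r" "t < horizon D" "x \<in> space (global_state_sp D t)"
    and XU: "(X, U) \<in> admissible_processes D t x"
  shows "has_expect (prob_sp D) (total_cost D t X U)"
proof -
  have "\<forall>(X, U)\<in>admissible_processes D t x. has_expect (prob_sp D) (total_cost D t X U)"
    using assms(1-3) unfolding expectations_well_defined_def by blast
  from bspec[OF this XU] show ?thesis by simp
qed

context independent_noise begin

lemma stage_cost_measurable:
  "s < T \<Longrightarrow> i \<in> I \<Longrightarrow> (\<lambda>(x, u, w). stage_cost D s i x u w) \<in> borel_measurable
    (state_sp D s i \<Otimes>\<^sub>M control_sp D s i \<Otimes>\<^sub>M noise_sp D (Suc s) i)"
  using wp by (auto simp: well_posed_def)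

lemma stage_cost_neq_MInfty:
  assumes "s < T" "i \<in> I" "x \<in> space (state_sp D s i)" "u \<in> space (control_sp D s i)"
    "w \<in> space (noise_sp D (Suc s) i)"
  shows "stage_cost D s i x u w \<noteq> - \<infinity>"
proof -
  have "- \<infinity> < stage_cost D s i x u w"
    using wp assms unfolding well_posed_def by blast
  then show ?thesis by auto
qed

lemma priced_cost_measurable:
  assumes "s < T" "i \<in> I" "q \<in> space (price_sp D s i)"
  shows "(\<lambda>(x, u, w). stage_cost D s i x u w + ereal (pairing D s i q (resource D s i x u)))
    \<in> borel_measurable (state_sp D s i \<Otimes>\<^sub>M control_sp D s i \<Otimes>\<^sub>M noise_sp D (Suc s) i)"
proof -
  let ?N = "state_sp D s i \<Otimes>\<^sub>M control_sp D s i \<Otimes>\<^sub>M noise_sp D (Suc s) i"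
  have res: "(\<lambda>(x, u). resource D s i x u) \<in> state_sp D s i \<Otimes>\<^sub>M control_sp D s i \<rightarrow>\<^sub>M resource_sp D s i"
    and pair: "(\<lambda>(q, y). pairing D s i q y) \<in> borel_measurable (price_sp D s i \<Otimes>\<^sub>M resource_sp D s i)"
    using wp assms(1,2) by (auto simp: well_posed_def)
  have proj: "(\<lambda>(x, u, w). (x, u)) \<in> ?N \<rightarrow>\<^sub>M state_sp D s i \<Otimes>\<^sub>M control_sp D s i"
    by measurable
  have "(\<lambda>z. case z of (x, u, w) \<Rightarrow> resource D s i x u) \<in> ?N \<rightarrow>\<^sub>M resource_sp D s i"
    using measurable_compose[OF proj res] by (simp add: split_beta)
  then have "(\<lambda>z. (q, case z of (x, u, w) \<Rightarrow> resource D s i x u)) \<in> ?N \<rightarrow>\<^sub>M price_sp D s i \<Otimes>\<^sub>M resource_sp D s i"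
    using assms(3) by (intro measurable_Pair measurable_const)
  from measurable_compose[OF this pair]
  have [measurable]: "(\<lambda>(x, u, w). pairing D s i q (resource D s i x u)) \<in> borel_measurable ?N"
    by (simp add: split_beta)
  note [measurable] = stage_cost_measurable[OF assms(1,2)]
  have "(\<lambda>z. (case z of (x, u, w) \<Rightarrow> stage_cost D s i x u w) +
      ereal (case z of (x, u, w) \<Rightarrow> pairing D s i q (resource D s i x u))) \<in> borel_measurable ?N"
    by measurable
  then show ?thesis by (simp add: split_beta)
qed

text \<open>
  An element of \<open>- S\<^sub>s\<close> is the negative of some \<open>z\<close> in \<open>S\<^sub>s\<close>, and the pairing with \<open>z\<close> is
  nonnegative by admissibility of the price.
\<close>

lemma pairing_neg_coupling_nonpos:
  assumes "price_admissible D p" "s < T" "(\<lambda>i\<in>I. y i) \<in> neg_coupling D s"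
  shows "(\<Sum>i\<in>I. pairing D s i (p s i) (y i)) \<le> 0"
proof -
  obtain z where z: "z \<in> coupling D s" and y: "(\<lambda>i\<in>I. y i) = (\<lambda>i\<in>I. - z i)"
    using assms(3) by (auto simp: neg_coupling_def)
  have "z \<in> space (global_resource_sp D s)" using wp assms(2) z by (auto simp: well_posed_def)
  then have z_space: "z i \<in> space (resource_sp D s i)" if "i \<in> I" for i
    using that by (auto simp: global_resource_sp_def space_PiM PiE_mem)
  have "pairing D s i (p s i) (y i) = - pairing D s i (p s i) (z i)" if i: "i \<in> I" for i
  proof -
    have "bilinear_form_on (space (price_sp D s i)) (space (resource_sp D s i)) (pairing D s i)"
      using wp i assms(2) by (auto simp: well_posed_def)
    moreover have "p s i \<in> space (price_sp D s i)"
      using assms(1,2) i by (auto simp: price_admissible_def)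
    ultimately have "pairing D s i (p s i) ((-1) *\<^sub>R z i) = (-1) * pairing D s i (p s i) (z i)"
      using z_space[OF i] unfolding bilinear_form_on_def by blast
    moreover have "y i = - z i" using fun_cong[OF y, of i] i by simp
    ultimately show ?thesis by simp
  qed
  then have "(\<Sum>i\<in>I. pairing D s i (p s i) (y i)) = - (\<Sum>i\<in>I. pairing D s i (p s i) (z i))"
    by (simp add: sum_negf)
  also have "\<dots> \<le> 0" using assms(1,2) z by (auto simp: price_admissible_def)
  finally show ?thesis .
qed

text \<open>
  Summing the Bellman inequalities of the units could fail only because the sum of the unit
  expectations mixes \<open>\<infinity>\<close> and \<open>-\<infinity>\<close>. As the price values are below \<open>\<infinity>\<close>, either one of them is
  \<open>-\<infinity>\<close> and then so is their sum, or all unit integrands have integrable negative parts and the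
  expectation is additive.
\<close>

lemma sum_price_value_le_expect:
  assumes wd: "expectations_well_defined D p r" and bd: "local_values_bounded D p r"
    and s: "s < T" and x: "\<And>i. i \<in> I \<Longrightarrow> x i \<in> space (state_sp D s i)"
    and u: "\<And>i. i \<in> I \<Longrightarrow> u i \<in> space (control_sp D s i)"
  defines "g \<equiv> \<lambda>i. price_integrand D p s i (price_value D p (Suc s) i) (x i) (u i)"
  shows "(\<Sum>i\<in>I. price_value D p s i (x i)) \<le> expect M (\<lambda>\<omega>. \<Sum>i\<in>I. g i \<omega>)"
    and "(\<Sum>i\<in>I. price_value D p s i (x i)) \<noteq> - \<infinity> \<Longrightarrow> has_expect M (\<lambda>\<omega>. \<Sum>i\<in>I. g i \<omega>)"
proof -
  have g: "has_expect M (g i)" if "i \<in> I" for i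
    using wd s x u that by (auto simp: expectations_well_defined_def g_def)
  have le: "price_value D p s i (x i) \<le> expect M (g i)" if "i \<in> I" for i
    unfolding price_value.simps[of D p s] g_def using s u[OF that] by (auto intro: INF_lower)
  have fin: "neg_integral M (\<lambda>\<omega>. \<Sum>i\<in>I. g i \<omega>) < \<infinity> \<and>
      expect M (\<lambda>\<omega>. \<Sum>i\<in>I. g i \<omega>) = (\<Sum>i\<in>I. expect M (g i))"
    if neq: "(\<Sum>i\<in>I. price_value D p s i (x i)) \<noteq> - \<infinity>"
  proof (rule expect_sum)
    fix i assume i: "i \<in> I"
    have lt: "price_value D p s j (x j) < \<infinity>" if "j \<in> I" for j
      using bd s x that by (auto simp: local_values_bounded_def)
    then have "(\<Sum>i\<in>I. price_value D p s i (x i)) \<noteq> \<infinity>"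
      by (auto simp: sum_Pinfty)
    with neq have "\<bar>\<Sum>i\<in>I. price_value D p s i (x i)\<bar> \<noteq> \<infinity>"
      by auto
    with i have "price_value D p s i (x i) \<noteq> - \<infinity>"
      by (auto simp: sum_Inf)
    with le[OF i] have "expect M (g i) \<noteq> - \<infinity>" by auto
    with g[OF i] show "neg_integral M (g i) < \<infinity>" by (simp add: neg_integral_finite_iff)
  qed (use g in \<open>simp add: has_expect_def\<close>)
  then show "(\<Sum>i\<in>I. price_value D p s i (x i)) \<le> expect M (\<lambda>\<omega>. \<Sum>i\<in>I. g i \<omega>)"
    using le by (cases "(\<Sum>i\<in>I. price_value D p s i (x i)) = - \<infinity>") (auto intro: sum_mono)
  show "has_expect M (\<lambda>\<omega>. \<Sum>i\<in>I. g i \<omega>)" if "(\<Sum>i\<in>I. price_value D p s i (x i)) \<noteq> - \<infinity>"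
    using fin[OF that] g by (auto simp: has_expect_def intro!: borel_measurable_ereal_sum)
qed

text \<open>
  The price terms lower the total cost, almost surely. If its expectation is \<open>\<infinity>\<close> the bound is trivial;
  otherwise its positive part is integrable, hence so is that of the cost with price terms, to which
  dynamic programming applies.
\<close>

lemma sum_price_value_le_total_cost:
  assumes p: "price_admissible D p" and wd: "expectations_well_defined D p r"
    and bd: "local_values_bounded D p r" and t: "t < T" "x \<in> space (global_state_sp D t)"
    and XU: "(X, U) \<in> admissible_processes D t x"
  shows "(\<Sum>i\<in>I. price_value D p t i (x i)) \<le> expect M (total_cost D t X U)"
proof -
  let ?c = "\<lambda>s i x u w. stage_cost D s i x u w + ereal (pairing D s i (p s i) (resource D s i x u))"
  interpret dynamic_programming D t x X U ?c "price_value D p"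
  proof
    show "adapted_trajectory D t x X U"
      using XU by (simp add: admissible_iff_adapted_trajectory)
    show "(\<lambda>(x, u, w). ?c s i x u w)
      \<in> borel_measurable (state_sp D s i \<Otimes>\<^sub>M control_sp D s i \<Otimes>\<^sub>M noise_sp D (Suc s) i)"
      if "s < T" "i \<in> I" for s i
      using p that by (intro priced_cost_measurable) (auto simp: price_admissible_def)
    show "price_value D p s i \<in> borel_measurable (state_sp D s i)" if "s \<in> {1..T}" "i \<in> I" for s i
      using wd that by (auto simp: expectations_well_defined_def)
  qed (use t stage_cost_neq_MInfty in auto)
  have next_value: "next_value s \<omega> (global_noise D (Suc s) \<omega>') =
      (\<Sum>i\<in>I. price_integrand D p s i (price_value D p (Suc s) i) (X s i \<omega>) (U s i \<omega>) \<omega>')" for s \<omega> \<omega>'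
    by (simp add: next_value_def price_integrand_def global_noise_def)
  have terminal: "running_value T \<omega> = total_cost D t X U \<omega> +
      ereal (\<Sum>s=t..<T. \<Sum>i\<in>I. pairing D s i (p s i) (resource D s i (X s i \<omega>) (U s i \<omega>)))" for \<omega>
    unfolding running_value_def accumulated_cost_def value_to_go_def total_cost_def
    by (subst (2) sum.swap) (simp add: sum.distrib price_value.simps[of D p T] ac_simps)
  have "AE \<omega> in M. \<forall>s\<in>{t..<T}. (\<lambda>i\<in>I. resource D s i (X s i \<omega>) (U s i \<omega>)) \<in> neg_coupling D s"
    using XU by (intro AE_finite_allI) (auto simp: admissible_iff_adapted_trajectory)
  then have le: "AE \<omega> in M. running_value T \<omega> \<le> total_cost D t X U \<omega>"
  proof (rule AE_mp, intro AE_I2 impI)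
    fix \<omega> assume "\<forall>s\<in>{t..<T}. (\<lambda>i\<in>I. resource D s i (X s i \<omega>) (U s i \<omega>)) \<in> neg_coupling D s"
    then have "(\<Sum>s=t..<T. \<Sum>i\<in>I. pairing D s i (p s i) (resource D s i (X s i \<omega>) (U s i \<omega>))) \<le> 0"
      using p by (intro sum_nonpos pairing_neg_coupling_nonpos) auto
    then show "running_value T \<omega> \<le> total_cost D t X U \<omega>"
      unfolding terminal by (cases "total_cost D t X U \<omega>") auto
  qed
  have has: "has_expect M (total_cost D t X U)"
    using has_expect_total_cost[OF wd t XU] .
  show ?thesis
  proof (cases "expect M (total_cost D t X U) = \<infinity>")
    case False
    have "pos_integral M (running_value T) \<le> pos_integral M (total_cost D t X U)"
      using le by (intro nn_integral_mono_AE) (auto elim!: eventually_mono intro: e2ennreal_mono)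
    also have "\<dots> < \<infinity>" using False has by (simp add: pos_integral_finite_iff)
    finally have "(\<Sum>i\<in>I. price_value D p t i (x i)) \<le> expect M (running_value T)"
      using sum_price_value_le_expect[OF wd bd] in_spaces
      unfolding value_to_go_def
      by (intro expect_terminal_ge) (auto simp: next_value value_to_go_def)
    also have "\<dots> \<le> expect M (total_cost D t X U)" using le by (rule expect_mono)
    finally show ?thesis .
  qed simp
qed

end

section \<open>Trajectories of policies\<close>

lemma policy_state_start [simp]: "policy_state D \<gamma> t x t \<omega> = x"
  by (cases t) auto

context independent_noise begin

lemma policy_state_adapted:
  assumes \<gamma>: "policy D \<gamma>" and x: "x \<in> space (global_state_sp D t)" and s: "t \<le> s" "s \<le> T"
  shows "policy_state D \<gamma> t x s \<in> noise_filtration D s \<rightarrow>\<^sub>M global_state_sp D s"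
  using s
proof (induction s rule: dec_induct)
  case base
  then show ?case using x by (simp add: fun_eq_iff measurable_const cong: measurable_cong)
next
  case (step s)
  let ?X = "policy_state D \<gamma> t x s"
  let ?F = "noise_filtration D (Suc s)"
  have X: "?X \<in> ?F \<rightarrow>\<^sub>M global_state_sp D s"
    using step by (auto intro: measurable_noise_filtration_mono[where s=s])
  have "(\<lambda>\<omega>. \<gamma> s (?X \<omega>)) \<in> ?F \<rightarrow>\<^sub>M global_control_sp D s"
    using \<gamma> step.prems by (intro measurable_compose[OF X]) (auto simp: policy_def)
  then have *: "(\<lambda>\<omega>. ?X \<omega> i) \<in> ?F \<rightarrow>\<^sub>M state_sp D s i" "(\<lambda>\<omega>. \<gamma> s (?X \<omega>) i) \<in> ?F \<rightarrow>\<^sub>M control_sp D s i"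
    if "i \<in> I" for i
    using X that unfolding global_control_sp_def global_state_sp_def
    by (auto intro: measurable_compose measurable_component_singleton)
  have "(\<lambda>\<omega>. \<lambda>i\<in>I. dyn D s i (?X \<omega> i) (\<gamma> s (?X \<omega>) i) (noise D (Suc s) i \<omega>)) \<in> ?F \<rightarrow>\<^sub>M global_state_sp D (Suc s)"
    unfolding global_state_sp_def using step.prems
    by (intro measurable_restrict measurable_uncurried3[OF dyn_measurable] * noise_adapted) auto
  moreover have "policy_state D \<gamma> t x (Suc s) =
      (\<lambda>\<omega>. \<lambda>i\<in>I. dyn D s i (?X \<omega> i) (\<gamma> s (?X \<omega>) i) (noise D (Suc s) i \<omega>))"
    using step.hyps by (auto simp: fun_eq_iff)
  ultimately show ?case by (simp only:)
qed

lemma policy_state_in_space: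
  assumes "policy D \<gamma>" "x \<in> space (global_state_sp D t)" "t \<le> s" "s \<le> T" "\<omega> \<in> space M"
  shows "policy_state D \<gamma> t x s \<omega> \<in> space (global_state_sp D s)"
  using measurable_space[OF policy_state_adapted[OF assms(1-4)]] assms(5) by simp

text \<open>
  The resulting controls depend measurably on a state that is computed from past noises only.
\<close>

lemma policy_admissible:
  assumes \<gamma>: "policy D \<gamma>" and x: "x \<in> space (global_state_sp D t)"
    and feas: "\<And>s x. s < T \<Longrightarrow> x \<in> space (global_state_sp D s) \<Longrightarrow> feasible_control D s x (\<gamma> s x)"
  shows "(\<lambda>s i \<omega>. policy_state D \<gamma> t x s \<omega> i, \<lambda>s i \<omega>. \<gamma> s (policy_state D \<gamma> t x s \<omega>) i)
    \<in> admissible_processes D t x"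
proof -
  have "(\<lambda>\<omega>. \<gamma> s (policy_state D \<gamma> t x s \<omega>) i) \<in> noise_filtration D s \<rightarrow>\<^sub>M control_sp D s i"
    if "s \<in> {t..<T}" "i \<in> I" for s i
  proof -
    have "(\<lambda>\<omega>. \<gamma> s (policy_state D \<gamma> t x s \<omega>)) \<in> noise_filtration D s \<rightarrow>\<^sub>M global_control_sp D s"
      using \<gamma> that by (intro measurable_compose[OF policy_state_adapted[OF \<gamma> x]]) (auto simp: policy_def)
    then show ?thesis using that unfolding global_control_sp_def
      by (auto intro: measurable_compose measurable_component_singleton)
  qed
  moreover have "AE \<omega> in M. (\<lambda>i\<in>I. resource D s i (policy_state D \<gamma> t x s \<omega> i)
      (\<gamma> s (policy_state D \<gamma> t x s \<omega>) i)) \<in> neg_coupling D s" if "s \<in> {t..<T}" for s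
    using feas policy_state_in_space[OF \<gamma> x] that by (intro AE_I2) (auto simp: feasible_control_def)
  ultimately show ?thesis
    by (auto simp: admissible_iff_adapted_trajectory adapted_trajectory_def)
qed

lemma global_value_le_policy_value:
  assumes "global_policy D V \<gamma>" "t < T" "x \<in> space (global_state_sp D t)"
  shows "global_value D t x \<le> policy_value D \<gamma> t x"
proof -
  have "policy D \<gamma>"
    "\<And>s x. s < T \<Longrightarrow> x \<in> space (global_state_sp D s) \<Longrightarrow> feasible_control D s x (\<gamma> s x)"
    using assms(1) by (auto simp: global_policy_def is_arg_min_def)
  from policy_admissible[OF this(1) assms(3) this(2)] assms(2) show ?thesis
    unfolding global_value_def policy_value_def policy_cost_def
    by (auto intro!: INF_lower2[where i="(_, _)"])
qed

lemma policy_value_horizon: "policy_value D \<gamma> T x = (\<Sum>i\<in>I. final_cost D i (x i))"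
proof -
  have "policy_cost D \<gamma> T x = (\<lambda>_. \<Sum>i\<in>I. final_cost D i (x i))"
    by (simp add: policy_cost_def total_cost_def fun_eq_iff)
  then show ?thesis by (simp add: policy_value_def expect_const)
qed

end

section \<open>Upper bound by the resource value functions\<close>

context independent_noise begin

text \<open>
  Nearly optimal controls of the units respect the given resource, hence are jointly feasible,
  and \<open>u0\<close> does at least as well. Since resource values are above \<open>-\<infinity>\<close>, these controls give
  integrable negative parts, so that the expectation is additive over the units.
\<close>

lemma expect_policy_integrand_le:
  assumes r: "resource_admissible D r" and wd: "expectations_well_defined D p r"
    and bd: "local_values_bounded D p r"
    and s: "s < T" and x: "x \<in> space (global_state_sp D s)"
    and opt: "is_arg_min (\<lambda>u. expect M (policy_integrand D (resource_value D r) s x u))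
      (feasible_control D s x) u0"
  shows "expect M (policy_integrand D (resource_value D r) s x u0)
    \<le> (\<Sum>i\<in>I. resource_value D r s i (x i))"
proof (cases "(\<Sum>i\<in>I. resource_value D r s i (x i)) = \<infinity>")
  case False
  let ?v = "\<lambda>i. resource_value D r s i (x i)"
  let ?g = "\<lambda>i. plain_integrand D s i (resource_value D r (Suc s) i) (x i)"
  have xi: "x i \<in> space (state_sp D s i)" if "i \<in> I" for i
    using x that by (auto simp: global_state_sp_def space_PiM PiE_mem)
  have v_INF: "?v i = (INF u \<in> resource_controls D r s i (x i). expect M (?g i u))" for i
    using s by (simp add: resource_value.simps[of D r s])
  have v_gt: "- \<infinity> < ?v i" if "i \<in> I" for i
    using bd s xi that by (auto simp: local_values_bounded_def)
  have v_lt: "?v i < \<infinity>" if "i \<in> I" for i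
    using False that by (auto simp: sum_Pinfty)
  show ?thesis
  proof (rule ereal_le_epsilon2)
    fix e :: real assume "0 < e"
    \<comment> \<open>The tolerance per unit; adding 1 avoids division by 0 when there are no units.\<close>
    define d where "d = e / (real (card I) + 1)"
    have d: "0 < d" "real (card I) * d \<le> e"
      using \<open>0 < e\<close> by (auto simp: d_def field_simps)
    have "\<exists>u. u \<in> resource_controls D r s i (x i) \<and> expect M (?g i u) < ?v i + ereal d"
      if "i \<in> I" for i
    proof -
      have "?v i < ?v i + ereal d" using v_gt[OF that] v_lt[OF that] d by (cases "?v i") auto
      then show ?thesis by (subst (asm) (1) v_INF) (auto simp: INF_less_iff)
    qed
    then obtain u where u: "\<And>i. i \<in> I \<Longrightarrow> u i \<in> resource_controls D r s i (x i)"
      and u_lt: "\<And>i. i \<in> I \<Longrightarrow> expect M (?g i (u i)) < ?v i + ereal d"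
      by metis
    have g: "has_expect M (?g i (u i))" if "i \<in> I" for i
      using wd s xi u that by (auto simp: expectations_well_defined_def)
    have "neg_integral M (?g i (u i)) < \<infinity>" if "i \<in> I" for i
    proof -
      have "?v i \<le> expect M (?g i (u i))" unfolding v_INF by (rule INF_lower) (rule u[OF that])
      then show ?thesis using g[OF that] v_gt[OF that] by (auto simp: neg_integral_finite_iff)
    qed
    then have sum: "expect M (\<lambda>\<omega>. \<Sum>i\<in>I. ?g i (u i) \<omega>) = (\<Sum>i\<in>I. expect M (?g i (u i)))"
      using g by (intro expect_sum[THEN conjunct2]) (auto simp: has_expect_def)
    let ?u = "\<lambda>i\<in>I. u i"
    have "(\<lambda>i\<in>I. resource D s i (x i) (?u i)) = (\<lambda>i\<in>I. r s i)"
      using u by (auto simp: resource_controls_def fun_eq_iff)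
    then have "feasible_control D s x ?u"
      using r s u
      by (auto simp: feasible_control_def resource_admissible_def global_control_sp_def space_PiM
          resource_controls_def)
    then have "expect M (policy_integrand D (resource_value D r) s x u0)
        \<le> expect M (policy_integrand D (resource_value D r) s x ?u)"
      using opt by (auto simp: is_arg_min_def not_less)
    also have "policy_integrand D (resource_value D r) s x ?u = (\<lambda>\<omega>. \<Sum>i\<in>I. ?g i (u i) \<omega>)"
      by (auto simp: policy_integrand_def fun_eq_iff)
    also have "expect M \<dots> \<le> (\<Sum>i\<in>I. ?v i + ereal d)"
      unfolding sum using u_lt by (intro sum_mono less_imp_le)
    also have "\<dots> = (\<Sum>i\<in>I. ?v i) + ereal (real (card I) * d)"
      by (simp add: sum.distrib)
    also have "\<dots> \<le> (\<Sum>i\<in>I. ?v i) + ereal e"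
      using d by (intro add_left_mono) simp
    finally show "expect M (policy_integrand D (resource_value D r) s x u0) \<le> (\<Sum>i\<in>I. ?v i) + ereal e" .
  qed
qed simp

text \<open>
  If the cost of the policy has expectation \<open>-\<infinity>\<close> the bound is trivial. Otherwise its negative part is
  integrable, because the trajectory is admissible and its cost therefore has an expectation; this
  starts the backward induction.
\<close>

lemma policy_value_le_sum_resource_value:
  assumes r: "resource_admissible D r" and wd: "expectations_well_defined D p r"
    and bd: "local_values_bounded D p r" and \<gamma>: "global_resource_policy D r \<gamma>"
    and t: "t < T" "x \<in> space (global_state_sp D t)"
  shows "policy_value D \<gamma> t x \<le> (\<Sum>i\<in>I. resource_value D r t i (x i))"
proof -
  let ?X = "\<lambda>s i \<omega>. policy_state D \<gamma> t x s \<omega> i"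
  let ?U = "\<lambda>s i \<omega>. \<gamma> s (policy_state D \<gamma> t x s \<omega>) i"
  have pol: "policy D \<gamma>"
    and opt: "\<And>s x. s < T \<Longrightarrow> x \<in> space (global_state_sp D s) \<Longrightarrow>
        is_arg_min (\<lambda>u. expect M (policy_integrand D (resource_value D r) s x u))
          (feasible_control D s x) (\<gamma> s x)"
    using \<gamma> by (auto simp: global_resource_policy_def global_policy_def)
  then have feas: "\<And>s x. s < T \<Longrightarrow> x \<in> space (global_state_sp D s) \<Longrightarrow> feasible_control D s x (\<gamma> s x)"
    by (auto simp: is_arg_min_def)
  have XU: "(?X, ?U) \<in> admissible_processes D t x"
    by (rule policy_admissible[OF pol t(2) feas])
  interpret dynamic_programming D t x ?X ?U "stage_cost D" "resource_value D r"
  proof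
    show "adapted_trajectory D t x ?X ?U"
      using XU by (simp add: admissible_iff_adapted_trajectory)
    show "resource_value D r s i \<in> borel_measurable (state_sp D s i)" if "s \<in> {1..T}" "i \<in> I" for s i
      using wd that by (auto simp: expectations_well_defined_def)
  qed (use t stage_cost_neq_MInfty stage_cost_measurable in auto)
  have next_value: "next_value s \<omega> (global_noise D (Suc s) \<omega>') = policy_integrand D (resource_value D r) s
      (policy_state D \<gamma> t x s \<omega>) (\<gamma> s (policy_state D \<gamma> t x s \<omega>)) \<omega>'" for s \<omega> \<omega>'
    by (simp add: next_value_def policy_integrand_def plain_integrand_def global_noise_def)
  have terminal: "running_value T = policy_cost D \<gamma> t x"
    unfolding running_value_def accumulated_cost_def value_to_go_def policy_cost_def total_cost_def fun_eq_iff
    by (subst sum.swap) (simp add: resource_value.simps[of D r T])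
  have has: "has_expect M (policy_cost D \<gamma> t x)"
    using has_expect_total_cost[OF wd t XU] by (simp add: policy_cost_def)
  show ?thesis
  proof (cases "expect M (policy_cost D \<gamma> t x) = - \<infinity>")
    case False
    have "expect M (running_value T) \<le> (\<Sum>i\<in>I. resource_value D r t i (x i))"
    proof (rule expect_terminal_le)
      show "neg_integral M (running_value T) < \<infinity>"
        using False has unfolding terminal by (simp add: neg_integral_finite_iff)
      fix s \<omega> assume s: "t \<le> s" "s < T" "\<omega> \<in> space M"
      then have X: "policy_state D \<gamma> t x s \<omega> \<in> space (global_state_sp D s)"
        by (intro policy_state_in_space[OF pol t(2)]) auto
      show "expect M (\<lambda>\<omega>'. next_value s \<omega> (global_noise D (Suc s) \<omega>')) \<le> value_to_go s \<omega>"
        unfolding next_value value_to_go_def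
        by (rule expect_policy_integrand_le[OF r wd bd s(2) X opt[OF s(2) X]])
      show "has_expect M (\<lambda>\<omega>'. next_value s \<omega> (global_noise D (Suc s) \<omega>'))"
        unfolding next_value using wd s(2) X feas[OF s(2) X]
        by (auto simp: expectations_well_defined_def)
    qed
    then show ?thesis by (simp add: terminal policy_value_def)
  qed (simp add: policy_value_def)
qed

end

section \<open>Bounds on the global value\<close>

theorem proposition5:
  fixes D :: "('i, 'x, 'u, 'w, 'r::real_vector, 'p::real_vector, 'o) multistage"
    and p :: "nat \<Rightarrow> 'i \<Rightarrow> 'p"
    and r :: "nat \<Rightarrow> 'i \<Rightarrow> 'r"
    and \<gamma>_price \<gamma>_resource :: "nat \<Rightarrow> ('i \<Rightarrow> 'x) \<Rightarrow> 'i \<Rightarrow> 'u"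
    and t :: nat
    and x :: "'i \<Rightarrow> 'x"
  assumes "well_posed D"
    and "prob_space.indep_vars (prob_sp D) (global_noise_sp D) (global_noise D) {1..horizon D}"
    and "price_admissible D p"
    and "resource_admissible D r"
    and "expectations_well_defined D p r"
    and "local_values_bounded D p r"
    and "global_price_policy D p \<gamma>_price"
    and "global_resource_policy D r \<gamma>_resource"
    and "t \<le> horizon D"
    and "x \<in> space (global_state_sp D t)"
  shows "(\<Sum>i\<in>units D. price_value D p t i (x i)) \<le> global_value D t x \<and>
         global_value D t x \<le> policy_value D \<gamma>_resource t x \<and>
         policy_value D \<gamma>_resource t x \<le> (\<Sum>i\<in>units D. resource_value D r t i (x i)) \<and>
         global_value D t x \<le> inf (policy_value D \<gamma>_price t x) (policy_value D \<gamma>_resource t x)"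
proof -
  interpret independent_noise D using assms(1,2) by unfold_locales
  show ?thesis
  proof (cases "t < T")
    case True
    have "(\<Sum>i\<in>I. price_value D p t i (x i)) \<le> global_value D t x"
      using sum_price_value_le_total_cost[OF assms(3,5,6) True assms(10)] True
      by (auto simp: global_value_def intro!: INF_greatest)
    moreover have "global_value D t x \<le> policy_value D \<gamma>_price t x"
      "global_value D t x \<le> policy_value D \<gamma>_resource t x"
      using assms(7,8,10) True
      by (auto simp: global_price_policy_def global_resource_policy_def intro: global_value_le_policy_value)
    moreover have "policy_value D \<gamma>_resource t x \<le> (\<Sum>i\<in>I. resource_value D r t i (x i))"
      using assms True by (intro policy_value_le_sum_resource_value) auto
    ultimately show ?thesis by simp
  next
    case False
    with assms(9) have "t = T" by simp
    then show ?thesis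
      by (simp add: policy_value_horizon global_value_def price_value.simps[of D p T]
          resource_value.simps[of D r T])
  qed
qed

end
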